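(* Let $m,n\ge 0$ and consider the root system of $\mathfrak{gl}(m|n)$, the set $\mathbb S$ of bases whose positive even roots agree with those of $\Sigma^{\mathrm{dist}}$, and the partially ordered set $\mathcal R$ of right odd roots. Then: (1) The map $\Sigma\mapsto \Sigma\cap\mathcal R$ is a bijection between $\mathbb S$ and the collection of incomparable subsets of $\mathcal R$. (2) For $\Sigma\in\mathbb S$ let $B_\Sigma:=\mathcal R\setminus\{\alpha\in\mathcal R \mid \exists\,\beta\in\Sigma\cap\mathcal R \text{ such that } \alpha\ge\beta\}$. Then $\Sigma$ can be obtained from $\Sigma^{\mathrm{dist}}$ by performing the odd reflections with respect to all the roots in $B_\Sigma$ (each once), in some valid order; i.e. there is an ordering $(\alpha_1,\dots,\alpha_k)$ of the elements of $B_\Sigma$ such that $\alpha_{t+1}\in r_{\alpha_t}\circ\cdots\circ r_{\alpha_1}(\Sigma^{\mathrm{dist}})$ for all $0\le t\le k-1$ and $r_{\alpha_k}\circ\cdots\circ r_{\alpha_1}(\Sigma^{\mathrm{dist}})=\Sigma$.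
   Context: Fix $m,n\ge 0$ and the complex Lie superalgebra $\mathfrak{gl}(m|n)$ with Cartan subalgebra $\mathfrak h$ of diagonal matrices. Let $\varepsilon_1,\dots,\varepsilon_m,\delta_1,\dots,\delta_n$ be the basis of $\mathfrak h^*$ dual to $E_{1,1},\dots,E_{m+n,m+n}$, with the symmetric bilinear form such that this basis is orthogonal, $(\varepsilon_i|\varepsilon_i)=1$, $(\delta_j|\delta_j)=-1$. The root system $\Delta$ consists of the even roots $\varepsilon_i-\varepsilon_j$, $\delta_i-\delta_j$ ($i\ne j$) and the odd roots $\pm(\varepsilon_i-\delta_j)$ ($1\le i\le m$, $1\le j\le n$). A base is a linearly independent $\Sigma\subset\Delta$ such that every root is an integer combination of elements of $\Sigma$ with all coefficients $\ge0$ (positive roots for $\Sigma$) or all $\le 0$ (negative roots). The distinguished base is $\Sigma^{\mathrm{dist}}=\{\varepsilon_i-\varepsilon_{i+1},\ \varepsilon_m-\delta_1,\ \delta_j-\delta_{j+1}\}$ ($1\le i\le m-1$, $1\le j\le n-1$). $\mathbb S$ is the set of bases whose set of positive even roots equals that of $\Sigma^{\mathrm{dist}}$, i.e. $\{\varepsilon_i-\varepsilon_j,\delta_i-\delta_j\mid i<j\}$. Right odd roots: $\mathcal R=\{\varepsilon_i-\delta_j\mid 1\le i\le m,1\le j\le n\}$, partially ordered by $\varepsilon_i-\delta_j\le\varepsilon_k-\delta_l$ iff $i\ge k$ and $j\le l$. A subset of $\mathcal R$ is incomparable if no two distinct elements of it are comparable. Odd reflection: for a base $\Sigma$ and an odd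 root $\alpha\in\Sigma$, $r_\alpha(\Sigma)$ is the base consisting of $-\alpha$, of all $\beta\in\Sigma\setminus\{\alpha\}$ with $(\beta|\alpha)=0$, and of $\beta+\alpha$ for all $\beta\in\Sigma\setminus\{\alpha\}$ with $(\beta|\alpha)\ne0$. *)

theory Defs
  imports Complex_Main "HOL-Library.Function_Algebras"
begin

text \<open>
  A weight, i.e. an element of the dual of the Cartan subalgebra of diagonal matrices of
  \<open>gl(m|n)\<close>, is encoded by its values on the diagonal matrix units: the function \<open>f\<close> stands for
  the functional sending the \<open>k\<close>-th diagonal matrix unit to \<open>f k\<close>, for \<open>1 \<le> k \<le> m + n\<close>, and
  \<open>f\<close> is zero at all other indices. Addition is pointwise.
\<close>

type_synonym weight = "nat \<Rightarrow> complex"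

definition wscale :: "complex \<Rightarrow> weight \<Rightarrow> weight" where
  "wscale c f = (\<lambda>k. c * f k)"

global_interpretation weight: vector_space wscale
  by unfold_locales (auto simp: wscale_def algebra_simps)

definition eps :: "nat \<Rightarrow> weight" where
  "eps i = (\<lambda>k. if k = i then 1 else 0)"

definition del :: "nat \<Rightarrow> nat \<Rightarrow> weight" where
  "del m j = (\<lambda>k. if k = m + j then 1 else 0)"

definition wform :: "nat \<Rightarrow> nat \<Rightarrow> weight \<Rightarrow> weight \<Rightarrow> complex" where
  "wform m n f g = (\<Sum>k\<in>{1..m}. f k * g k) - (\<Sum>k\<in>{m+1..m+n}. f k * g k)"

definition even_roots :: "nat \<Rightarrow> nat \<Rightarrow> weight set" where
  "even_roots m n =
     {eps i - eps j | i j. i \<in> {1..m} \<and> j \<in> {1..m} \<and> i \<noteq> j} \<union>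
     {del m i - del m j | i j. i \<in> {1..n} \<and> j \<in> {1..n} \<and> i \<noteq> j}"

definition right_odd_roots :: "nat \<Rightarrow> nat \<Rightarrow> weight set" where
  "right_odd_roots m n = {eps i - del m j | i j. i \<in> {1..m} \<and> j \<in> {1..n}}"

definition odd_roots :: "nat \<Rightarrow> nat \<Rightarrow> weight set" where
  "odd_roots m n = right_odd_roots m n \<union> uminus ` right_odd_roots m n"

definition roots :: "nat \<Rightarrow> nat \<Rightarrow> weight set" where
  "roots m n = even_roots m n \<union> odd_roots m n"

definition positive_roots :: "nat \<Rightarrow> nat \<Rightarrow> weight set \<Rightarrow> weight set" where
  "positive_roots m n S =
     {\<alpha> \<in> roots m n. \<exists>c :: weight \<Rightarrow> int.
        (\<forall>\<beta>\<in>S. 0 \<le> c \<beta>) \<and> \<alpha> = (\<Sum>\<beta>\<in>S. wscale (of_int (c \<beta>)) \<beta>)}"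

definition negative_roots :: "nat \<Rightarrow> nat \<Rightarrow> weight set \<Rightarrow> weight set" where
  "negative_roots m n S =
     {\<alpha> \<in> roots m n. \<exists>c :: weight \<Rightarrow> int.
        (\<forall>\<beta>\<in>S. c \<beta> \<le> 0) \<and> \<alpha> = (\<Sum>\<beta>\<in>S. wscale (of_int (c \<beta>)) \<beta>)}"

definition is_base :: "nat \<Rightarrow> nat \<Rightarrow> weight set \<Rightarrow> bool" where
  "is_base m n S \<longleftrightarrow>
     S \<subseteq> roots m n \<and> weight.independent S \<and>
     (\<forall>\<alpha>\<in>roots m n. \<alpha> \<in> positive_roots m n S \<or> \<alpha> \<in> negative_roots m n S)"

text \<open>The root \<open>eps m - del m 1\<close> exists only if \<open>m\<close> and \<open>n\<close> are both positive.\<close>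

definition dist_base :: "nat \<Rightarrow> nat \<Rightarrow> weight set" where
  "dist_base m n =
     {eps i - eps (i + 1) | i. 1 \<le> i \<and> i < m} \<union>
     (if 1 \<le> m \<and> 1 \<le> n then {eps m - del m 1} else {}) \<union>
     {del m j - del m (j + 1) | j. 1 \<le> j \<and> j < n}"

definition bases_SS :: "nat \<Rightarrow> nat \<Rightarrow> weight set set" where
  "bases_SS m n =
     {S. is_base m n S \<and>
         positive_roots m n S \<inter> even_roots m n =
         positive_roots m n (dist_base m n) \<inter> even_roots m n}"

definition odd_le :: "nat \<Rightarrow> nat \<Rightarrow> weight \<Rightarrow> weight \<Rightarrow> bool" where
  "odd_le m n \<alpha> \<beta> \<longleftrightarrow>
     (\<exists>i\<in>{1..m}. \<exists>j\<in>{1..n}. \<exists>k\<in>{1..m}. \<exists>l\<in>{1..n}.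
        \<alpha> = eps i - del m j \<and> \<beta> = eps k - del m l \<and> i \<ge> k \<and> j \<le> l)"

definition incomparable :: "nat \<Rightarrow> nat \<Rightarrow> weight set \<Rightarrow> bool" where
  "incomparable m n A \<longleftrightarrow>
     A \<subseteq> right_odd_roots m n \<and>
     (\<forall>\<alpha>\<in>A. \<forall>\<beta>\<in>A. \<alpha> \<noteq> \<beta> \<longrightarrow> \<not> odd_le m n \<alpha> \<beta> \<and> \<not> odd_le m n \<beta> \<alpha>)"

text \<open>Total in \<open>\<alpha>\<close> and \<open>S\<close>; meaningful for a base \<open>S\<close> and an odd root \<open>\<alpha> \<in> S\<close>.\<close>

definition odd_reflection :: "nat \<Rightarrow> nat \<Rightarrow> weight \<Rightarrow> weight set \<Rightarrow> weight set" where
  "odd_reflection m n \<alpha> S =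
     {- \<alpha>} \<union>
     {\<beta> \<in> S - {\<alpha>}. wform m n \<beta> \<alpha> = 0} \<union>
     {\<beta> + \<alpha> | \<beta>. \<beta> \<in> S - {\<alpha>} \<and> wform m n \<beta> \<alpha> \<noteq> 0}"

definition B_set :: "nat \<Rightarrow> nat \<Rightarrow> weight set \<Rightarrow> weight set" where
  "B_set m n S =
     right_odd_roots m n -
     {\<alpha> \<in> right_odd_roots m n. \<exists>\<beta> \<in> S \<inter> right_odd_roots m n. odd_le m n \<beta> \<alpha>}"

end

theory Submission imports Defs begin

text \<open>
  Since \<open>del m j = eps (m + j)\<close>, the roots are the \<open>eps a - eps b\<close> with \<open>a \<noteq> b\<close> in \<open>{1..m+n}\<close>: as a
  set this is the root system of type A, so a base amounts to a total order of \<open>{1..m+n}\<close>,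
  written as a list, the simple roots being the differences of adjacent letters. The bases with
  the distinguished even part are the lists in which the letters \<open>\<le> m\<close> and the letters \<open>> m\<close> both
  appear in increasing order, and an odd reflection transposes two adjacent letters of different
  kind. Writing \<open>(i, m + j)\<close> for the right odd root \<open>eps i - del m j\<close>, such a list is determined by
  the set of pairs that it inverts. These sets are exactly the down-sets of the poset of right odd
  roots; the simple right odd roots are the minimal elements of the complement, so \<open>B_set\<close> is the
  inversion set, and a down-set is built up from the empty set by adding one minimal element of
  the complement at a time.
\<close>

section \<open>Lists and their order relations\<close>

text \<open>Under \<open>rt\<close> this relation becomes the set of positive roots of the base
  attached to a list, and \<open>adj\<close> below becomes the base itself.\<close>

fun before :: "'a list \<Rightarrow> ('a \<times> 'a) set" where
  "before [] = {}"
| "before (x # xs) = {x} \<times> set xs \<union> before xs"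

fun adj :: "'a list \<Rightarrow> ('a \<times> 'a) set" where
  "adj (x # y # xs) = insert (x, y) (adj (y # xs))"
| "adj _ = {}"

lemma before_subset: "before xs \<subseteq> set xs \<times> set xs"
  by (induction xs) auto

lemma before_in_set: "(a, b) \<in> before xs \<Longrightarrow> a \<in> set xs \<and> b \<in> set xs"
  using before_subset[of xs] by auto

lemma before_append: "before (xs @ ys) = before xs \<union> set xs \<times> set ys \<union> before ys"
  by (induction xs) auto

text \<open>No letter stands between \<open>a\<close> and \<open>b\<close>, so every other pair
  keeps its order. Hence an odd reflection adds just one element to the inversion set.\<close>

lemma before_swap:
  assumes "distinct (us @ a # b # ws)"
  shows "before (us @ b # a # ws) = insert (b, a) (before (us @ a # b # ws) - {(a, b)})"
proof -
  \<comment> \<open>\<open>Z\<close> collects the pairs common to both relations; distinctness keeps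
    \<open>(a, b)\<close> out of it, so removing \<open>(a, b)\<close> leaves exactly
    \<open>Z\<close>.\<close>
  define Z where "Z = before us \<union> set us \<times> insert a (insert b (set ws)) \<union>
    {a} \<times> set ws \<union> {b} \<times> set ws \<union> before ws"
  have "before (us @ a # b # ws) = insert (a, b) Z" "before (us @ b # a # ws) = insert (b, a) Z"
    unfolding Z_def by (auto simp: before_append)
  moreover have "(a, b) \<notin> Z"
    using assms unfolding Z_def by (auto dest: before_in_set)
  ultimately show ?thesis by simp
qed

lemma before_total:
  "a \<in> set xs \<Longrightarrow> b \<in> set xs \<Longrightarrow> a \<noteq> b \<Longrightarrow> (a, b) \<in> before xs \<or> (b, a) \<in> before xs"
  by (induction xs) auto

lemma before_asym: "distinct xs \<Longrightarrow> (a, b) \<in> before xs \<Longrightarrow> (b, a) \<notin> before xs"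
  by (induction xs) (auto dest: before_in_set)

lemma before_irrefl: "distinct xs \<Longrightarrow> (a, a) \<notin> before xs"
  using before_asym by metis

lemma before_trans:
  "distinct xs \<Longrightarrow> (a, b) \<in> before xs \<Longrightarrow> (b, c) \<in> before xs \<Longrightarrow> (a, c) \<in> before xs"
  by (induction xs) (auto dest: before_in_set)

lemma before_decomp: "(a, b) \<in> before xs \<Longrightarrow> \<exists>us vs ws. xs = us @ a # vs @ b # ws"
proof (induction xs)
  case (Cons x xs)
  show ?case
  proof (cases "(a, b) \<in> before xs")
    case True
    then obtain us vs ws where "xs = us @ a # vs @ b # ws" using Cons.IH by blast
    then have "x # xs = (x # us) @ a # vs @ b # ws" by simp
    then show ?thesis by blast
  next
    case False
    then have "x = a" "b \<in> set xs" using Cons.prems by auto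
    then obtain vs ws where "xs = vs @ b # ws" by (meson split_list)
    then have "x # xs = [] @ a # vs @ b # ws" using \<open>x = a\<close> by simp
    then show ?thesis by blast
  qed
qed simp

text \<open>The head is the letter preceding all others, so it can be read off from the relation,
  and then one recurses. Equality of the letter sets matters because every one-letter list has the
  empty relation.\<close>

lemma before_inject:
  assumes "distinct xs" "distinct ys" "set xs = set ys" "before xs = before ys"
  shows "xs = ys"
  using assms
proof (induction xs arbitrary: ys)
  case (Cons x xs)
  obtain y ys' where ys: "ys = y # ys'" using Cons.prems(3) by (cases ys) auto
  have xy: "x = y"
  proof (rule ccontr)
    assume "x \<noteq> y"
    moreover have "y \<in> set (x # xs)" "x \<in> set ys"
      using Cons.prems(3) ys list.set_intros(1) by metis+
    ultimately have "(x, y) \<in> before (x # xs)" "(y, x) \<in> before ys" unfolding ys by simp_all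
    then show False using before_asym[OF Cons.prems(1)] Cons.prems(4) by metis
  qed
  have notin: "x \<notin> set xs" "x \<notin> set ys'" using Cons.prems(1,2) unfolding ys xy by auto
  have s: "set xs = set ys'"
    using Cons.prems(3) notin unfolding ys xy[symmetric] list.set by (simp add: insert_ident)
  have tl: "before zs = before (z # zs) - {z} \<times> UNIV" if "z \<notin> set zs" for z :: 'a and zs
    using before_in_set[of z _ zs] that by auto
  have b: "before xs = before ys'"
    using tl[OF notin(1)] tl[OF notin(2)] Cons.prems(4) unfolding ys xy[symmetric] by metis
  show ?case
    using Cons.IH[OF _ _ s b] Cons.prems(1,2) unfolding ys xy by simp
qed simp

section \<open>Adjacent letters of a list\<close>

lemma adj_append:
  "adj (xs @ ys) =
     adj xs \<union> (if xs \<noteq> [] \<and> ys \<noteq> [] then {(last xs, hd ys)} else {}) \<union> adj ys"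
proof (induction xs rule: adj.induct)
  case ("2_2" x)
  then show ?case by (cases ys) auto
qed auto

lemma adj_Cons: "adj (x # xs) = (if xs = [] then {} else {(x, hd xs)}) \<union> adj xs"
  by (cases xs) auto

lemma adj_before: "adj xs \<subseteq> before xs"
  by (induction xs rule: adj.induct) auto

lemma adj_in_set: "(a, b) \<in> adj xs \<Longrightarrow> a \<in> set xs \<and> b \<in> set xs"
  using adj_before before_in_set by fast

lemma finite_adj [simp]: "finite (adj xs)"
  by (induction xs rule: adj.induct) auto

lemma adj_neq: "distinct xs \<Longrightarrow> (a, b) \<in> adj xs \<Longrightarrow> a \<noteq> b"
  using adj_before before_irrefl by fast

lemma adj_before_cases:
  "distinct xs \<Longrightarrow> (a, b) \<in> adj xs \<Longrightarrow> (a, c) \<in> before xs \<Longrightarrow> c = b \<or> (b, c) \<in> before xs"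
  by (induction xs rule: adj.induct) (auto dest: before_in_set adj_in_set)

text \<open>On the way from a letter \<open>\<le> m\<close> to a letter \<open>> m\<close> the kind
  must change somewhere, and the adjacent letters at that place are \<open>c\<close> and
  \<open>d\<close>. This later finds a simple right odd root below a given positive one.\<close>

lemma before_switch:
  fixes m :: nat
  assumes "(a, b) \<in> before xs" "a \<le> m" "m < b"
  shows "\<exists>c d. (c, d) \<in> adj xs \<and> c \<le> m \<and> m < d \<and>
           (a = c \<or> (a, c) \<in> before xs) \<and> (d = b \<or> (d, b) \<in> before xs)"
  using assms
proof (induction xs arbitrary: a)
  case (Cons x xs)
  let ?Q = "\<lambda>xs a c d. (c, d) \<in> adj xs \<and> c \<le> m \<and> m < d \<and>
    (a = c \<or> (a, c) \<in> before xs) \<and> (d = b \<or> (d, b) \<in> before xs)"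
  have lift: "?Q (x # xs) a c d" if "?Q xs a c d" for a c d
    using that by (auto simp: adj_Cons)
  show ?case
  proof (cases "(a, b) \<in> before xs")
    case True
    then obtain c d where "?Q xs a c d" using Cons.IH[OF True Cons.prems(2,3)] by blast
    then show ?thesis using lift by blast
  next
    case False
    then have a: "a = x" "b \<in> set xs" using Cons.prems by auto
    then obtain y ys where xs: "xs = y # ys" by (cases xs) auto
    show ?thesis
    proof (cases "m < y")
      case True
      then have "?Q (x # xs) a x y" using a xs Cons.prems by auto
      then show ?thesis by blast
    next
      case False
      then have "(y, b) \<in> before xs" using a xs Cons.prems by auto
      then obtain c d where cd: "?Q xs y c d"
        using Cons.IH[of y] Cons.prems False by (meson not_le)
      then have "(x, c) \<in> before (x # xs)" using adj_in_set[of c d xs] by auto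
      then have "?Q (x # xs) a c d" using lift[OF cd] a by blast
      then show ?thesis by blast
    qed
  qed
qed simp

lemma in_adj_upt: "(i, j) \<in> adj [a..<b] \<longleftrightarrow> a \<le> i \<and> j = Suc i \<and> j < b"
proof (induction b)
  case (Suc b)
  show ?case
  proof (cases "a < b")
    case True
    then have "adj [a..<Suc b] = insert (b - 1, b) (adj [a..<b])"
      by (simp add: adj_append last_upt)
    then show ?thesis using Suc.IH True by auto
  qed (auto simp: not_less le_less)
qed simp

lemma adj_upt: "adj [a..<b] = {(i, Suc i) | i. a \<le> i \<and> Suc i < b}"
  by (intro set_eqI) (simp only: split_paired_all in_adj_upt, auto)

lemma in_before_upt: "(i, j) \<in> before [a..<b] \<longleftrightarrow> a \<le> i \<and> i < j \<and> j < b"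
  by (induction b) (auto simp: before_append)

text \<open>Take out the least element, sort the rest by induction, and put the least element in
  front. This turns the positivity order of a base into a list.\<close>

lemma strict_order_list:
  assumes "finite A" "asymp_on A P" "transp_on A P" "totalp_on A P"
  shows "\<exists>xs. distinct xs \<and> set xs = A \<and> (\<forall>a b. (a, b) \<in> before xs \<longleftrightarrow> a \<in> A \<and> b \<in> A \<and> P a b)"
  using assms
proof (induction "card A" arbitrary: A)
  case 0
  then have "A = {}" by simp
  then show ?case by (intro exI[of _ "[]"]) simp
next
  case (Suc k)
  have "A \<noteq> {}" using Suc.hyps(2) by auto
  then obtain z where z: "z \<in> A" "\<And>x. x \<in> A \<Longrightarrow> x \<noteq> z \<Longrightarrow> P z x"
    using Finite_Set.bex_least_element[OF Suc.prems(1) \<open>A \<noteq> {}\<close> Suc.prems(3,4)] by blast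
  have "k = card (A - {z})" using Suc.hyps(2) Suc.prems(1) z(1) by simp
  moreover have "finite (A - {z})" "A - {z} \<subseteq> A" using Suc.prems(1) by auto
  ultimately obtain xs where xs: "distinct xs" "set xs = A - {z}"
      "\<forall>a b. (a, b) \<in> before xs \<longleftrightarrow> a \<in> A - {z} \<and> b \<in> A - {z} \<and> P a b"
    using Suc.hyps(1)[of "A - {z}"] asymp_on_subset[OF Suc.prems(2)]
      transp_on_subset[OF Suc.prems(3)] totalp_on_subset[OF Suc.prems(4)] by blast
  \<comment> \<open>The case \<open>a = z\<close> is included, since asymmetry excludes
    \<open>P z z\<close>.\<close>
  have nz: "\<not> P a z" if "a \<in> A" for a
    using z that asymp_onD[OF Suc.prems(2)] by (cases "a = z") blast+
  have "(a, b) \<in> before (z # xs) \<longleftrightarrow> a \<in> A \<and> b \<in> A \<and> P a b" for a b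
    using z(1) z(2)[of b] nz[of a] nz[of z] by (cases "a = z"; cases "b = z") (auto simp: xs(2,3))
  moreover have "distinct (z # xs)" "set (z # xs) = A" using xs(1,2) z(1) by auto
  ultimately show ?case by blast
qed

section \<open>Nonnegative integral combinations\<close>

text \<open>Finiteness of \<open>S\<close> matters: a sum over an infinite set is 0 by convention,
  so the cone of an infinite set is just \<open>{0}\<close>.\<close>

definition cone :: "weight set \<Rightarrow> weight set" where
  "cone S = {\<Sum>\<beta>\<in>S. wscale (of_int (c \<beta>)) \<beta> | c. \<forall>\<beta>\<in>S. 0 \<le> (c \<beta> :: int)}"

lemma wscale_sum_int_add:
  "(\<Sum>\<beta>\<in>S. wscale (of_int (c \<beta> + d \<beta>)) \<beta>) =
    (\<Sum>\<beta>\<in>S. wscale (of_int (c \<beta>)) \<beta>) + (\<Sum>\<beta>\<in>S. wscale (of_int (d \<beta>)) \<beta>)"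
  by (simp add: weight.scale_left_distrib sum.distrib)

lemma cone_add: "\<alpha> \<in> cone S \<Longrightarrow> \<beta> \<in> cone S \<Longrightarrow> \<alpha> + \<beta> \<in> cone S"
proof -
  assume "\<alpha> \<in> cone S" "\<beta> \<in> cone S"
  then obtain c d where c: "\<forall>\<beta>\<in>S. 0 \<le> (c \<beta> :: int)" "\<forall>\<beta>\<in>S. 0 \<le> (d \<beta> :: int)"
    and e: "\<alpha> = (\<Sum>\<beta>\<in>S. wscale (of_int (c \<beta>)) \<beta>)" "\<beta> = (\<Sum>\<beta>\<in>S. wscale (of_int (d \<beta>)) \<beta>)"
    unfolding cone_def by blast
  have "\<alpha> + \<beta> = (\<Sum>\<beta>\<in>S. wscale (of_int (c \<beta> + d \<beta>)) \<beta>)"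
    unfolding e wscale_sum_int_add ..
  moreover have "\<forall>\<beta>\<in>S. 0 \<le> c \<beta> + d \<beta>" using c by auto
  ultimately show ?thesis unfolding cone_def
    by (intro CollectI exI[of _ "\<lambda>\<beta>. c \<beta> + d \<beta>"]) auto
qed

lemma cone_mono: "finite T \<Longrightarrow> S \<subseteq> T \<Longrightarrow> cone S \<subseteq> cone T"
proof
  fix \<alpha> assume T: "finite T" "S \<subseteq> T" and "\<alpha> \<in> cone S"
  then obtain c where c: "\<forall>\<beta>\<in>S. 0 \<le> (c \<beta> :: int)" "\<alpha> = (\<Sum>\<beta>\<in>S. wscale (of_int (c \<beta>)) \<beta>)"
    unfolding cone_def by blast
  let ?d = "\<lambda>\<beta>. if \<beta> \<in> S then c \<beta> else 0"
  have "(\<Sum>\<beta>\<in>T. wscale (of_int (?d \<beta>)) \<beta>) = \<alpha>"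
    unfolding c(2) using T by (intro sum.mono_neutral_cong_right) auto
  then show "\<alpha> \<in> cone T" unfolding cone_def using c(1)
    by (intro CollectI exI[of _ ?d]) auto
qed

lemma cone_base: "finite S \<Longrightarrow> \<beta> \<in> S \<Longrightarrow> \<beta> \<in> cone S"
proof -
  assume S: "finite S" "\<beta> \<in> S"
  have "(\<Sum>\<gamma>\<in>S. wscale (of_int (if \<gamma> = \<beta> then 1 else 0)) \<gamma>) = (\<Sum>\<gamma>\<in>S. if \<gamma> = \<beta> then \<beta> else 0)"
    by (intro sum.cong) auto
  also have "\<dots> = \<beta>" using S by simp
  finally show ?thesis unfolding cone_def
    by (intro CollectI exI[of _ "\<lambda>\<gamma>. if \<gamma> = \<beta> then 1 else 0"]) auto
qed

text \<open>Adding the coefficients of \<open>\<alpha>\<close> and \<open>- \<alpha>\<close> gives a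
  linear relation on \<open>S\<close>, so all the sums vanish, and with nonnegative summands each
  coefficient does. This makes the positivity order asymmetric.\<close>

lemma cone_pointed:
  assumes S: "finite S" "weight.independent S" and "\<alpha> \<in> cone S" "- \<alpha> \<in> cone S"
  shows "\<alpha> = 0"
proof -
  obtain c d where c: "\<forall>\<beta>\<in>S. 0 \<le> (c \<beta> :: int)" "\<forall>\<beta>\<in>S. 0 \<le> (d \<beta> :: int)"
    and e: "\<alpha> = (\<Sum>\<beta>\<in>S. wscale (of_int (c \<beta>)) \<beta>)" "- \<alpha> = (\<Sum>\<beta>\<in>S. wscale (of_int (d \<beta>)) \<beta>)"
    using assms(3,4) unfolding cone_def by blast
  have "(\<Sum>\<beta>\<in>S. wscale (of_int (c \<beta> + d \<beta>)) \<beta>) = 0"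
    unfolding wscale_sum_int_add e[symmetric] by simp
  then have "of_int (c \<beta> + d \<beta>) = (0 :: complex)" if "\<beta> \<in> S" for \<beta>
    using weight.independentD[OF S(2,1) subset_refl, of "\<lambda>\<beta>. of_int (c \<beta> + d \<beta>)"] that by blast
  then have "c \<beta> = 0" if "\<beta> \<in> S" for \<beta>
    using c that by (metis add_nonneg_eq_0_iff of_int_eq_0_iff)
  then show ?thesis unfolding e by simp
qed

lemma positive_roots_cone: "positive_roots m n S = roots m n \<inter> cone S"
  unfolding positive_roots_def cone_def by blast

lemma negative_roots_cone: "negative_roots m n S = {\<alpha> \<in> roots m n. - \<alpha> \<in> cone S}"
proof -
  have *: "(\<exists>c :: weight \<Rightarrow> int. (\<forall>\<beta>\<in>S. c \<beta> \<le> 0) \<and> \<alpha> = (\<Sum>\<beta>\<in>S. wscale (of_int (c \<beta>)) \<beta>)) \<longleftrightarrow>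
      - \<alpha> \<in> cone S" for \<alpha>
  proof
    assume "\<exists>c :: weight \<Rightarrow> int. (\<forall>\<beta>\<in>S. c \<beta> \<le> 0) \<and> \<alpha> = (\<Sum>\<beta>\<in>S. wscale (of_int (c \<beta>)) \<beta>)"
    then obtain c :: "weight \<Rightarrow> int"
      where c: "\<forall>\<beta>\<in>S. c \<beta> \<le> 0" "\<alpha> = (\<Sum>\<beta>\<in>S. wscale (of_int (c \<beta>)) \<beta>)" by blast
    then show "- \<alpha> \<in> cone S" unfolding cone_def
      by (intro CollectI exI[of _ "\<lambda>\<beta>. - c \<beta>"]) (auto simp: sum_negf)
  next
    assume "- \<alpha> \<in> cone S"
    then obtain c :: "weight \<Rightarrow> int"
      where c: "\<forall>\<beta>\<in>S. 0 \<le> c \<beta>" "- \<alpha> = (\<Sum>\<beta>\<in>S. wscale (of_int (c \<beta>)) \<beta>)"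
      unfolding cone_def by blast
    then have "\<alpha> = - (\<Sum>\<beta>\<in>S. wscale (of_int (c \<beta>)) \<beta>)" by (metis minus_minus)
    then show "\<exists>c :: weight \<Rightarrow> int. (\<forall>\<beta>\<in>S. c \<beta> \<le> 0) \<and> \<alpha> = (\<Sum>\<beta>\<in>S. wscale (of_int (c \<beta>)) \<beta>)"
      using c(1) by (intro exI[of _ "\<lambda>\<beta>. - c \<beta>"]) (auto simp: sum_negf)
  qed
  then show ?thesis unfolding negative_roots_def by simp
qed

section \<open>Recovering an independent generating set from its cone\<close>

lemma zero_cone: "0 \<in> cone S"
  unfolding cone_def by (intro CollectI exI[of _ "\<lambda>_. 0"]) auto

lemma cone_scale: "\<alpha> \<in> cone S \<Longrightarrow> 0 \<le> k \<Longrightarrow> wscale (of_int k) \<alpha> \<in> cone S"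
proof -
  assume "\<alpha> \<in> cone S" "0 \<le> k"
  then obtain c where c: "\<forall>\<beta>\<in>S. 0 \<le> (c \<beta> :: int)" "\<alpha> = (\<Sum>\<beta>\<in>S. wscale (of_int (c \<beta>)) \<beta>)"
    unfolding cone_def by blast
  then have "wscale (of_int k) \<alpha> = (\<Sum>\<beta>\<in>S. wscale (of_int (k * c \<beta>)) \<beta>)"
    by (simp add: weight.scale_sum_right)
  then show ?thesis using c(1) \<open>0 \<le> k\<close> unfolding cone_def
    by (intro CollectI exI[of _ "\<lambda>\<beta>. k * c \<beta>"]) auto
qed

lemma cone_least: "S \<subseteq> cone T \<Longrightarrow> cone S \<subseteq> cone T"
proof
  fix \<alpha> assume S: "S \<subseteq> cone T" and "\<alpha> \<in> cone S"
  then obtain c where c: "\<forall>\<beta>\<in>S. 0 \<le> (c \<beta> :: int)" "\<alpha> = (\<Sum>\<beta>\<in>S. wscale (of_int (c \<beta>)) \<beta>)"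
    unfolding cone_def by blast
  \<comment> \<open>The induction runs over subsets \<open>A\<close> with the coefficients fixed. An
    infinite \<open>A\<close> contributes the sum 0, which also lies in the cone.\<close>
  have "(\<Sum>\<beta>\<in>A. wscale (of_int (c \<beta>)) \<beta>) \<in> cone T" if "A \<subseteq> S" for A
    using that
    by (induction A rule: infinite_finite_induct)
       (use S c(1) in \<open>auto intro!: cone_add cone_scale zero_cone\<close>)
  then show "\<alpha> \<in> cone T" using c(2) by blast
qed

text \<open>Some coefficient of a nonzero element is at least 1, and lowering it by one stays in the
  cone.\<close>

lemma cone_split:
  assumes "finite S" "\<alpha> \<in> cone S" "\<alpha> \<noteq> 0"
  shows "\<exists>s\<in>S. \<alpha> - s \<in> cone S"
proof -
  obtain c where c: "\<forall>\<beta>\<in>S. 0 \<le> (c \<beta> :: int)" "\<alpha> = (\<Sum>\<beta>\<in>S. wscale (of_int (c \<beta>)) \<beta>)"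
    using assms(2) unfolding cone_def by blast
  have "\<exists>s\<in>S. c s \<noteq> 0"
  proof (rule ccontr)
    assume "\<not> (\<exists>s\<in>S. c s \<noteq> 0)"
    then have "\<alpha> = 0" unfolding c(2) by (intro sum.neutral) auto
    then show False using assms(3) by blast
  qed
  then obtain s where s: "s \<in> S" "1 \<le> c s" using c(1) by force
  let ?d = "\<lambda>\<beta>. c \<beta> + (if \<beta> = s then - 1 else 0)"
  have "(\<Sum>\<beta>\<in>S. wscale (of_int (if \<beta> = s then - 1 else 0)) \<beta>) =
      (\<Sum>\<beta>\<in>S. if \<beta> = s then - s else 0)"
    by (intro sum.cong) auto
  then have "\<alpha> - s = (\<Sum>\<beta>\<in>S. wscale (of_int (?d \<beta>)) \<beta>)"
    unfolding wscale_sum_int_add c(2) using assms(1) s(1) by simp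
  moreover have "\<forall>\<beta>\<in>S. 0 \<le> ?d \<beta>" using c(1) s(2) by auto
  ultimately have "\<alpha> - s \<in> cone S"
    unfolding cone_def by (intro CollectI exI[of _ ?d] conjI)
  then show ?thesis using s(1) by blast
qed

text \<open>By independence the coefficients of \<open>s\<close> and of \<open>\<beta> - s\<close>
  add up to the unit vector at \<open>\<beta>\<close>. So \<open>s\<close> is 0 or 1 times
  \<open>\<beta>\<close>, and 0 is excluded.\<close>

lemma cone_indecomposable:
  assumes T: "finite T" "weight.independent T" and "\<beta> \<in> T"
    and "s \<in> cone T" "s \<noteq> 0" "\<beta> - s \<in> cone T"
  shows "s = \<beta>"
proof -
  obtain c d where c: "\<forall>t\<in>T. 0 \<le> (c t :: int)" "\<forall>t\<in>T. 0 \<le> (d t :: int)"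
    and e: "s = (\<Sum>t\<in>T. wscale (of_int (c t)) t)" "\<beta> - s = (\<Sum>t\<in>T. wscale (of_int (d t)) t)"
    using assms(4,6) unfolding cone_def by blast
  \<comment> \<open>\<open>?b\<close> holds the coefficients of \<open>- \<beta>\<close>; together
    with \<open>c\<close> and \<open>d\<close> it gives a linear relation on
    \<open>T\<close>.\<close>
  let ?b = "\<lambda>t. if t = \<beta> then - 1 else (0 :: int)"
  have "(\<Sum>t\<in>T. wscale (of_int (?b t)) t) = (\<Sum>t\<in>T. if t = \<beta> then - \<beta> else 0)"
    by (intro sum.cong) auto
  then have "(\<Sum>t\<in>T. wscale (of_int (c t + d t + ?b t)) t) = 0"
    unfolding wscale_sum_int_add e[symmetric] using T(1) assms(3) by simp
  then have "of_int (c t + d t + ?b t) = (0 :: complex)" if "t \<in> T" for t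
    using weight.independentD[OF T(2,1) subset_refl, of "\<lambda>t. of_int (c t + d t + ?b t)"] that
    by blast
  then have cd: "c t + d t + ?b t = 0" if "t \<in> T" for t using that of_int_eq_0_iff by blast
  have "c t = 0" if "t \<in> T" "t \<noteq> \<beta>" for t
    using cd[OF that(1)] c that by (simp add: add_nonneg_eq_0_iff)
  then have "s = (\<Sum>t\<in>T. if t = \<beta> then wscale (of_int (c \<beta>)) \<beta> else 0)"
    unfolding e(1) by (intro sum.cong) auto
  then have s: "s = wscale (of_int (c \<beta>)) \<beta>" using T(1) assms(3) by simp
  have "c \<beta> + d \<beta> = 1" "0 \<le> c \<beta>" "0 \<le> d \<beta>" using cd[OF assms(3)] c assms(3) by auto
  moreover have "c \<beta> \<noteq> 0" using s assms(5) by auto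
  ultimately have "c \<beta> = 1" by linarith
  then show ?thesis using s by simp
qed

text \<open>Both sets consist of the indecomposable elements of the same cone: an element of
  \<open>T\<close> splits off some \<open>s\<close> in \<open>S\<close>, and indecomposability in
  \<open>cone T\<close> forces it to equal \<open>s\<close>.\<close>

lemma generators_unique:
  assumes "finite S" "weight.independent S" "finite T" "weight.independent T"
    and "S \<subseteq> cone T" "T \<subseteq> cone S"
  shows "S = T"
proof -
  have *: "T \<subseteq> S"
    if H: "finite S" "weight.independent S" "finite T" "weight.independent T"
      "S \<subseteq> cone T" "T \<subseteq> cone S" for S T
  proof
    fix \<beta> assume \<beta>: "\<beta> \<in> T"
    then have "\<beta> \<noteq> 0" using H(4) weight.dependent_zero by blast
    then obtain s where s: "s \<in> S" "\<beta> - s \<in> cone S" 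
      using cone_split[OF H(1), of \<beta>] H(6) \<beta> by blast
    then have "s \<noteq> 0" using H(2) weight.dependent_zero by blast
    then have "s = \<beta>" 
      using cone_indecomposable[OF H(3,4) \<beta>, of s] s H(5) cone_least[OF H(5)] by blast
    then show "\<beta> \<in> S" using s by simp
  qed
  show ?thesis using *[of S T] *[of T S] assms by blast
qed

section \<open>Bases as lists\<close>

text \<open>One notation for even and odd roots alike. On the diagonal the value is 0, so
  \<open>rt\<close> is injective only on pairs of distinct indices.\<close>

definition rt :: "nat \<times> nat \<Rightarrow> weight" where
  "rt p = eps (fst p) - eps (snd p)"

lemma rt_apply: "rt (a, b) k = (if k = a then 1 else 0) - (if k = b then 1 else 0)"
  by (simp add: rt_def eps_def)

lemma rt_eq_iff: "a \<noteq> b \<Longrightarrow> c \<noteq> d \<Longrightarrow> rt (a, b) = rt (c, d) \<longleftrightarrow> a = c \<and> b = d"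
proof
  assume "a \<noteq> b" "c \<noteq> d" "rt (a, b) = rt (c, d)"
  then have "rt (a, b) a = rt (c, d) a" "rt (a, b) b = rt (c, d) b" by auto
  then show "a = c \<and> b = d" using \<open>a \<noteq> b\<close> \<open>c \<noteq> d\<close> by (auto simp: rt_apply split: if_splits)
qed auto

lemma rt_neq_0: "a \<noteq> b \<Longrightarrow> rt (a, b) \<noteq> 0"
  using rt_apply[of a b a] by auto

lemma rt_minus: "- rt (a, b) = rt (b, a)"
  by (simp add: rt_def)

lemma rt_add: "rt (a, b) + rt (b, c) = rt (a, c)"
  by (simp add: rt_def)

lemma del_eps: "del m j = eps (m + j)"
  by (simp add: del_def eps_def)

lemma right_odd_roots_rt: "right_odd_roots m n = rt ` ({1..m} \<times> {m+1..m+n})"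
proof -
  have "right_odd_roots m n = {rt (i, m + j) | i j. i \<in> {1..m} \<and> j \<in> {1..n}}"
    unfolding right_odd_roots_def rt_def del_eps by simp
  also have "\<dots> = rt ` ({1..m} \<times> {m+1..m+n})"
  proof (intro equalityI subsetI)
    fix x assume "x \<in> rt ` ({1..m} \<times> {m+1..m+n})"
    then obtain i k where "x = rt (i, k)" "i \<in> {1..m}" "k \<in> {m+1..m+n}" by blast
    then show "x \<in> {rt (i, m + j) | i j. i \<in> {1..m} \<and> j \<in> {1..n}}"
      by (intro CollectI exI[of _ i] exI[of _ "k - m"]) auto
  qed auto
  finally show ?thesis .
qed

lemma even_roots_rt:
  "even_roots m n =
     {rt (a, b) | a b. a \<in> {1..m+n} \<and> b \<in> {1..m+n} \<and> a \<noteq> b \<and> (a \<le> m \<longleftrightarrow> b \<le> m)}"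
proof (intro equalityI subsetI)
  fix x assume "x \<in> even_roots m n"
  then show "x \<in> {rt (a, b) | a b. a \<in> {1..m+n} \<and> b \<in> {1..m+n} \<and> a \<noteq> b \<and> (a \<le> m \<longleftrightarrow> b \<le> m)}"
    unfolding even_roots_def del_eps rt_def by fastforce
next
  fix x assume "x \<in> {rt (a, b) | a b. a \<in> {1..m+n} \<and> b \<in> {1..m+n} \<and> a \<noteq> b \<and> (a \<le> m \<longleftrightarrow> b \<le> m)}"
  then obtain a b where x: "x = eps a - eps b" and ab: "a \<in> {1..m+n}" "b \<in> {1..m+n}" "a \<noteq> b"
      "a \<le> m \<longleftrightarrow> b \<le> m" by (auto simp: rt_def)
  show "x \<in> even_roots m n"
  proof (cases "a \<le> m")
    case True
    then show ?thesis using x ab unfolding even_roots_def by auto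
  next
    case False
    then have "x = del m (a - m) - del m (b - m)" "a - m \<in> {1..n}" "b - m \<in> {1..n}" "a - m \<noteq> b - m"
      using x ab unfolding del_eps by auto
    then show ?thesis unfolding even_roots_def by blast
  qed
qed

lemma roots_rt: "roots m n = {rt (a, b) | a b. a \<in> {1..m+n} \<and> b \<in> {1..m+n} \<and> a \<noteq> b}"
proof -
  have "uminus ` rt ` ({1..m} \<times> {m+1..m+n}) = rt ` ({m+1..m+n} \<times> {1..m})"
    by (force simp: rt_minus image_iff)
  then have r: "roots m n =
      {rt (a, b) | a b. a \<in> {1..m+n} \<and> b \<in> {1..m+n} \<and> a \<noteq> b \<and> (a \<le> m \<longleftrightarrow> b \<le> m)} \<union>
      (rt ` ({1..m} \<times> {m+1..m+n}) \<union> rt ` ({m+1..m+n} \<times> {1..m}))"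
    unfolding roots_def odd_roots_def right_odd_roots_rt even_roots_rt by simp
  have "rt (a, b) \<in> roots m n" if "a \<in> {1..m+n}" "b \<in> {1..m+n}" "a \<noteq> b" for a b
  proof -
    have "(a \<le> m \<longleftrightarrow> b \<le> m) \<or> (a, b) \<in> {1..m} \<times> {m+1..m+n} \<or> (a, b) \<in> {m+1..m+n} \<times> {1..m}"
      using that by auto
    then show ?thesis unfolding r using that by blast
  qed
  moreover have "roots m n \<subseteq> {rt (a, b) | a b. a \<in> {1..m+n} \<and> b \<in> {1..m+n} \<and> a \<noteq> b}"
    unfolding r by fastforce
  ultimately show ?thesis by blast
qed

lemma finite_roots: "finite (roots m n)"
proof -
  have "roots m n \<subseteq> rt ` ({1..m+n} \<times> {1..m+n})" unfolding roots_rt by auto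
  then show ?thesis by (rule finite_subset) auto
qed

section \<open>The base attached to a list and its positive roots\<close>

definition base_of :: "nat list \<Rightarrow> weight set" where
  "base_of xs = rt ` adj xs"

lemma finite_base_of [simp]: "finite (base_of xs)"
  by (simp add: base_of_def)

lemma base_of_Cons2: "base_of (x # y # xs) = insert (rt (x, y)) (base_of (y # xs))"
  by (simp add: base_of_def)

text \<open>Serves the independence proof: a new front letter \<open>x\<close> contributes a root
  that is nonzero at \<open>x\<close>, hence outside the span of the remaining roots.\<close>

lemma span_base_of_vanishes:
  assumes "w \<in> weight.span (base_of xs)" "x \<notin> set xs"
  shows "w x = 0"
  using assms(1)
proof (induction rule: weight.span_induct)
  case base
  show ?case by (auto simp: weight.subspace_def wscale_def)
next
  case (step w)
  then show ?case using assms(2) by (auto simp: base_of_def rt_apply dest: adj_in_set)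
qed

lemma independent_base_of: "distinct xs \<Longrightarrow> weight.independent (base_of xs)"
proof (induction xs rule: adj.induct)
  case (1 x y xs)
  have "rt (x, y) \<notin> weight.span (base_of (y # xs))"
    using span_base_of_vanishes[of "rt (x, y)" "y # xs" x] 1(2) by (auto simp: rt_apply)
  then show ?case using 1 by (simp add: base_of_Cons2 weight.independent_insert)
qed (auto simp: base_of_def weight.independent_empty)

text \<open>Telescoping: \<open>rt (a, b)\<close> is the sum of the differences of adjacent letters
  from \<open>a\<close> to \<open>b\<close>.\<close>

lemma before_cone_base_of: "(a, b) \<in> before xs \<Longrightarrow> rt (a, b) \<in> cone (base_of xs)"
proof (induction xs arbitrary: a rule: adj.induct)
  case (1 x y xs)
  have sub: "cone (base_of (y # xs)) \<subseteq> cone (base_of (x # y # xs))"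
    by (intro cone_mono) (auto simp: base_of_Cons2)
  have xy: "rt (x, y) \<in> cone (base_of (x # y # xs))"
    by (intro cone_base) (auto simp: base_of_Cons2)
  show ?case
  proof (cases "(a, b) \<in> before (y # xs)")
    case True
    then show ?thesis using 1 sub by blast
  next
    case False
    then have a: "a = x" "b = y \<or> b \<in> set xs" using 1(2) by auto
    show ?thesis
    proof (cases "b = y")
      case True
      then show ?thesis using a xy by simp
    next
      case False
      then have "rt (y, b) \<in> cone (base_of (x # y # xs))" using 1(1)[of y] a sub by auto
      then show ?thesis using cone_add[OF xy] a rt_add by metis
    qed
  qed
qed auto

text \<open>If \<open>b\<close> preceded \<open>a\<close>, both \<open>rt (a, b)\<close> and its
  negative would lie in the cone, against pointedness.\<close>

lemma cone_base_of_iff: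
  assumes "distinct xs" "a \<in> set xs" "b \<in> set xs" "a \<noteq> b"
  shows "rt (a, b) \<in> cone (base_of xs) \<longleftrightarrow> (a, b) \<in> before xs"
proof
  assume *: "rt (a, b) \<in> cone (base_of xs)"
  show "(a, b) \<in> before xs"
  proof (rule ccontr)
    assume "(a, b) \<notin> before xs"
    then have "rt (b, a) \<in> cone (base_of xs)" using before_total before_cone_base_of assms by metis
    then have "rt (a, b) = 0"
      using * cone_pointed independent_base_of assms finite_base_of rt_minus by metis
    then show False using assms rt_neq_0 by blast
  qed
qed (rule before_cone_base_of)

lemma is_base_base_of:
  assumes "distinct xs" "set xs = {1..m+n}"
  shows "is_base m n (base_of xs)"
  unfolding is_base_def
proof (intro conjI ballI)
  show "base_of xs \<subseteq> roots m n"
    using assms adj_in_set[of _ _ xs] adj_neq[OF assms(1)] unfolding base_of_def roots_rt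
    by fastforce
  show "weight.independent (base_of xs)" by (rule independent_base_of[OF assms(1)])
  fix \<alpha> assume \<alpha>: "\<alpha> \<in> roots m n"
  then obtain a b where "\<alpha> = rt (a, b)" "a \<in> set xs" "b \<in> set xs" "a \<noteq> b"
    unfolding roots_rt assms(2) by blast
  then show "\<alpha> \<in> positive_roots m n (base_of xs) \<or> \<alpha> \<in> negative_roots m n (base_of xs)"
    using \<alpha> before_total before_cone_base_of rt_minus
    unfolding positive_roots_cone negative_roots_cone by (metis (mono_tags, lifting) IntI mem_Collect_eq)
qed

text \<open>Positivity of \<open>rt (a, b)\<close> is a strict total order on the indices. Listing
  them along it gives a base with the same cone as \<open>S\<close>, hence \<open>S\<close>
  itself.\<close>

lemma base_is_base_of:
  assumes S: "is_base m n S"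
  shows "\<exists>xs. distinct xs \<and> set xs = {1..m+n} \<and> S = base_of xs"
proof -
  have sub: "S \<subseteq> roots m n" and ind: "weight.independent S"
    using S unfolding is_base_def by auto
  have pn0: "\<alpha> \<in> cone S \<or> - \<alpha> \<in> cone S" if "\<alpha> \<in> roots m n" for \<alpha>
    using S that unfolding is_base_def positive_roots_cone negative_roots_cone by auto
  have pn: "rt (a, b) \<in> cone S \<or> rt (b, a) \<in> cone S"
    if "a \<in> {1..m+n}" "b \<in> {1..m+n}" "a \<noteq> b" for a b
    using pn0[of "rt (a, b)"] that unfolding rt_minus roots_rt by blast
  have fin: "finite S" using sub finite_roots finite_subset by blast
  let ?P = "\<lambda>a b. a \<noteq> b \<and> rt (a, b) \<in> cone S"
  have asym: "\<not> ?P b a" if "?P a b" for a b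
    using cone_pointed[OF fin ind, of "rt (a, b)"] rt_neq_0 that by (auto simp: rt_minus)
  \<comment> \<open>The sum of the two roots lies in the cone; asymmetry rules out
    \<open>a = c\<close>, where that sum would be 0.\<close>
  have trans: "?P a c" if "?P a b" "?P b c" for a b c
    using asym that cone_add rt_add by metis
  have "asymp_on {1..m+n} ?P" using asym by (intro asymp_onI) metis
  moreover have "transp_on {1..m+n} ?P" by (rule transp_onI) (rule trans)
  moreover have "totalp_on {1..m+n} ?P" using pn by (intro totalp_onI) metis
  ultimately obtain xs where xs: "distinct xs" "set xs = {1..m+n}"
      "\<forall>a b. (a, b) \<in> before xs \<longleftrightarrow> a \<in> {1..m+n} \<and> b \<in> {1..m+n} \<and> ?P a b"
    using strict_order_list[of "{1..m+n}" ?P] by blast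
  have "S \<subseteq> cone (base_of xs)"
  proof
    fix s assume s: "s \<in> S"
    then obtain a b where ab: "s = rt (a, b)" "a \<in> {1..m+n}" "b \<in> {1..m+n}" "a \<noteq> b"
      using sub unfolding roots_rt by blast
    then have "(a, b) \<in> before xs" using xs(3) cone_base[OF fin s] by auto
    then show "s \<in> cone (base_of xs)" using before_cone_base_of ab by blast
  qed
  moreover have "base_of xs \<subseteq> cone S"
    using adj_before[of xs] xs(3) unfolding base_of_def by auto
  ultimately have "S = base_of xs"
    by (rule generators_unique[OF fin ind finite_base_of independent_base_of[OF xs(1)]])
  then show ?thesis using xs(1,2) by blast
qed

lemma dist_base_base_of: "dist_base m n = base_of [1..<Suc (m + n)]"
proof -
  have "base_of [1..<Suc (m + n)] = {rt (i, Suc i) | i. 1 \<le> i \<and> i < m + n}"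
    unfolding base_of_def adj_upt by auto
  also have "\<dots> = dist_base m n"
  proof (intro equalityI subsetI)
    fix x assume "x \<in> {rt (i, Suc i) | i. 1 \<le> i \<and> i < m + n}"
    then obtain i where i: "x = rt (i, Suc i)" "1 \<le> i" "i < m + n" by blast
    \<comment> \<open>For \<open>i = m\<close> the bounds \<open>1 \<le> i < m + n\<close> say
      exactly that \<open>m\<close> and \<open>n\<close> are positive, matching the conditional in
      \<open>dist_base\<close>.\<close>
    consider "i < m" | "i = m" | "m < i" by linarith
    then show "x \<in> dist_base m n"
    proof cases
      case 3
      then have "x = del m (i - m) - del m (i - m + 1)" "1 \<le> i - m" "i - m < n"
        using i by (auto simp: rt_def del_eps Suc_diff_le)
      then show ?thesis unfolding dist_base_def by blast
    qed (use i in \<open>auto simp: dist_base_def rt_def del_eps\<close>)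
  next
    fix x assume "x \<in> dist_base m n"
    then show "x \<in> {rt (i, Suc i) | i. 1 \<le> i \<and> i < m + n}"
      unfolding dist_base_def by (auto simp: rt_def del_eps split: if_splits)
  qed
  finally show ?thesis ..
qed

section \<open>Bases with the distinguished even part\<close>

definition shuffle_list :: "nat \<Rightarrow> nat \<Rightarrow> nat list \<Rightarrow> bool" where
  "shuffle_list m n xs \<longleftrightarrow> distinct xs \<and> set xs = {1..m+n} \<and>
     (\<forall>a b. (a, b) \<in> before xs \<longrightarrow> (a \<le> m \<longleftrightarrow> b \<le> m) \<longrightarrow> a < b)"

lemma shuffle_listD:
  assumes "shuffle_list m n xs"
  shows "distinct xs" "set xs = {1..m+n}"
    "(a, b) \<in> before xs \<Longrightarrow> (a \<le> m \<longleftrightarrow> b \<le> m) \<Longrightarrow> a < b"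
  using assms unfolding shuffle_list_def by blast+

lemma shuffle_list_less_before:
  assumes "shuffle_list m n xs" "a \<in> {1..m+n}" "b \<in> {1..m+n}" "a < b" "a \<le> m \<longleftrightarrow> b \<le> m"
  shows "(a, b) \<in> before xs"
proof -
  have "(b, a) \<notin> before xs"
  proof
    assume "(b, a) \<in> before xs"
    then have "b < a" using assms(5) by (intro shuffle_listD(3)[OF assms(1)]) auto
    then show False using assms(4) by simp
  qed
  then show ?thesis
    using before_total[of a xs b] shuffle_listD(2)[OF assms(1)] assms(2,3,4) by blast
qed

lemma shuffle_list_upt: "shuffle_list m n [1..<Suc (m + n)]"
proof -
  have "distinct [1..<Suc (m + n)]" "set [1..<Suc (m + n)] = {1..m+n}" by auto
  moreover have "a < b" if "(a, b) \<in> before [1..<Suc (m + n)]" for a b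
    using that unfolding in_before_upt by simp
  ultimately show ?thesis unfolding shuffle_list_def by simp
qed

lemma positive_even_base_of:
  assumes "distinct xs" "set xs = {1..m+n}"
  shows "positive_roots m n (base_of xs) \<inter> even_roots m n =
     rt ` {(a, b) \<in> before xs. a \<le> m \<longleftrightarrow> b \<le> m}"
proof -
  have "positive_roots m n (base_of xs) \<inter> even_roots m n = cone (base_of xs) \<inter> even_roots m n"
    by (auto simp: positive_roots_cone roots_def)
  also have "\<dots> = rt ` {(a, b) \<in> before xs. a \<le> m \<longleftrightarrow> b \<le> m}"
  proof (intro equalityI subsetI)
    fix x assume "x \<in> cone (base_of xs) \<inter> even_roots m n"
    then obtain a b where x: "x = rt (a, b)" "rt (a, b) \<in> cone (base_of xs)"
        "a \<in> set xs" "b \<in> set xs" "a \<noteq> b" "a \<le> m \<longleftrightarrow> b \<le> m"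
      unfolding even_roots_rt assms(2) by blast
    then have "(a, b) \<in> before xs" using cone_base_of_iff[OF assms(1)] by blast
    then have "(a, b) \<in> {(a, b) \<in> before xs. a \<le> m \<longleftrightarrow> b \<le> m}" using x(6) by simp
    then show "x \<in> rt ` {(a, b) \<in> before xs. a \<le> m \<longleftrightarrow> b \<le> m}" using x(1) by (rule rev_image_eqI)
  next
    fix x assume "x \<in> rt ` {(a, b) \<in> before xs. a \<le> m \<longleftrightarrow> b \<le> m}"
    then obtain a b where x: "x = rt (a, b)" "(a, b) \<in> before xs" "a \<le> m \<longleftrightarrow> b \<le> m" by auto
    have "a \<noteq> b" using x(2) before_irrefl[OF assms(1)] by metis
    moreover have "a \<in> {1..m+n}" "b \<in> {1..m+n}"
      using before_in_set[OF x(2)] unfolding assms(2) by simp_all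
    ultimately have "x \<in> even_roots m n" unfolding even_roots_rt using x(1,3) by blast
    then show "x \<in> cone (base_of xs) \<inter> even_roots m n"
      using before_cone_base_of[OF x(2)] x(1) by simp
  qed
  finally show ?thesis .
qed

text \<open>\<open>E\<close> is the part of the order between letters of the same kind. For the
  increasing list it contains all such pairs with \<open>a < b\<close>, so inclusion in it is the
  shuffle condition, and totality of the order gives the reverse inclusion.\<close>

lemma base_of_in_SS_iff:
  assumes "distinct xs" "set xs = {1..m+n}"
  shows "base_of xs \<in> bases_SS m n \<longleftrightarrow> shuffle_list m n xs"
proof -
  define E where "E ys = {(a, b) \<in> before ys. a \<le> m \<longleftrightarrow> b \<le> m}" for ys
  define I where "I = [1..<Suc (m + n)]"
  have I: "distinct I" "set I = {1..m+n}" unfolding I_def by auto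
  have inj: "inj_on rt {(a, b). a \<noteq> b}" by (auto simp: inj_on_def rt_eq_iff)
  have neq: "E ys \<subseteq> {(a, b). a \<noteq> b}" if "distinct ys" for ys
    using before_irrefl[OF that] unfolding E_def by auto
  have "base_of xs \<in> bases_SS m n \<longleftrightarrow> rt ` E xs = rt ` E I"
    unfolding bases_SS_def dist_base_base_of mem_Collect_eq I_def[symmetric] E_def
      positive_even_base_of[OF assms] positive_even_base_of[OF I]
    using is_base_base_of[OF assms] by simp
  also have "\<dots> \<longleftrightarrow> E xs = E I"
    by (rule inj_on_image_eq_iff[OF inj neq[OF assms(1)] neq[OF I(1)]])
  also have "\<dots> \<longleftrightarrow> shuffle_list m n xs"
  proof
    assume eq: "E xs = E I"
    have "a < b" if "(a, b) \<in> before xs" "a \<le> m \<longleftrightarrow> b \<le> m" for a b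
    proof -
      have "(a, b) \<in> E xs" unfolding E_def using that by simp
      then have "(a, b) \<in> E I" unfolding eq .
      then show ?thesis unfolding E_def I_def in_before_upt by simp
    qed
    then show "shuffle_list m n xs" unfolding shuffle_list_def using assms by simp
  next
    assume xs: "shuffle_list m n xs"
    have "(a, b) \<in> E xs \<longleftrightarrow> (a, b) \<in> E I" for a b
    proof
      assume "(a, b) \<in> E xs"
      then have ab: "(a, b) \<in> before xs" "a \<le> m \<longleftrightarrow> b \<le> m" unfolding E_def by simp_all
      then have "a < b" by (rule shuffle_listD(3)[OF xs])
      then show "(a, b) \<in> E I"
        using before_in_set[OF ab(1)] ab(2) assms(2) unfolding E_def I_def in_before_upt by simp
    next
      assume "(a, b) \<in> E I"
      then have ab: "1 \<le> a" "a < b" "b < Suc (m + n)" and s: "a \<le> m \<longleftrightarrow> b \<le> m"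
        unfolding E_def I_def in_before_upt by simp_all
      have "(a, b) \<in> before xs"
        using ab by (intro shuffle_list_less_before[OF xs _ _ _ s]) auto
      then show "(a, b) \<in> E xs" unfolding E_def using s by simp
    qed
    then show "E xs = E I" by (intro set_eqI) (simp only: split_paired_all)
  qed
  finally show ?thesis .
qed

lemma bases_SS_eq: "bases_SS m n = base_of ` {xs. shuffle_list m n xs}"
proof (intro equalityI subsetI)
  fix S assume S: "S \<in> bases_SS m n"
  then obtain xs where xs: "distinct xs" "set xs = {1..m+n}" "S = base_of xs"
    using base_is_base_of unfolding bases_SS_def by blast
  then show "S \<in> base_of ` {xs. shuffle_list m n xs}" using base_of_in_SS_iff S by blast
next
  fix S assume "S \<in> base_of ` {xs. shuffle_list m n xs}"
  then show "S \<in> bases_SS m n" using base_of_in_SS_iff shuffle_listD(1,2) by blast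
qed

section \<open>Odd reflections as adjacent transpositions\<close>

text \<open>The sign of the form on the \<open>\<delta>\<close> part cancels the sign of
  \<open>eps b\<close> in the root. So a root is orthogonal to \<open>rt (a, b)\<close> if it
  involves neither index, and not orthogonal if it involves exactly one.\<close>

lemma wform_rt:
  assumes "a \<in> {1..m}" "b \<in> {m+1..m+n}"
  shows "wform m n f (rt (a, b)) = f a + f b"
proof -
  have "(\<Sum>k\<in>{1..m}. f k * rt (a, b) k) = (\<Sum>k\<in>{1..m}. if k = a then f a else 0)"
    using assms by (intro sum.cong) (auto simp: rt_apply)
  moreover have "(\<Sum>k\<in>{m+1..m+n}. f k * rt (a, b) k) = (\<Sum>k\<in>{m+1..m+n}. if k = b then - f b else 0)"
    using assms by (intro sum.cong) (auto simp: rt_apply)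
  ultimately show ?thesis using assms by (simp add: wform_def)
qed

text \<open>Simple roots away from \<open>a\<close> and \<open>b\<close> are orthogonal to the
  reflecting root and stay. The at most two neighbouring ones are not orthogonal, and adding the
  root exchanges \<open>a\<close> and \<open>b\<close> in them.\<close>

lemma odd_reflection_base_of:
  assumes d: "distinct (us @ a # b # ws)" and ab: "a \<in> {1..m}" "b \<in> {m+1..m+n}"
  shows "odd_reflection m n (rt (a, b)) (base_of (us @ a # b # ws)) = base_of (us @ b # a # ws)"
proof -
  define \<alpha> where "\<alpha> = rt (a, b)"
  \<comment> \<open>\<open>L\<close> and \<open>R\<close> hold the letters next to the pair and are
    empty at an end of the list, so all boundary cases are treated at once.\<close>
  define Z where "Z = adj us \<union> adj ws"
  define L where "L = (if us = [] then {} else {last us})"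
  define R where "R = (if ws = [] then {} else {hd ws})"
  have ne: "a \<noteq> b" "a \<notin> set us" "a \<notin> set ws" "b \<notin> set us" "b \<notin> set ws" using d by auto
  have L: "L \<subseteq> set us" and R: "R \<subseteq> set ws" unfolding L_def R_def by auto
  have adj1: "adj (us @ a # b # ws) = insert (a, b) (Z \<union> (\<lambda>c. (c, a)) ` L \<union> (\<lambda>c. (b, c)) ` R)"
    by (auto simp: adj_append adj_Cons Z_def L_def R_def)
  have adj2: "adj (us @ b # a # ws) = insert (b, a) (Z \<union> (\<lambda>c. (c, b)) ` L \<union> (\<lambda>c. (a, c)) ` R)"
    by (auto simp: adj_append adj_Cons Z_def L_def R_def)
  have Z: "x \<noteq> a \<and> x \<noteq> b \<and> y \<noteq> a \<and> y \<noteq> b" if "(x, y) \<in> Z" for x y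
    using that ne adj_in_set unfolding Z_def by fast
  have LR: "x \<noteq> a \<and> x \<noteq> b" if "x \<in> L \<union> R" for x
    using that ne L R by blast
  define X where "X = rt ` Z"
  define Y where "Y = (\<lambda>c. rt (c, a)) ` L \<union> (\<lambda>c. rt (b, c)) ` R"
  have X: "\<beta> \<noteq> \<alpha> \<and> wform m n \<beta> \<alpha> = 0" if "\<beta> \<in> X" for \<beta>
  proof -
    have "\<beta> \<in> rt ` Z" using that unfolding X_def .
    then obtain p where "\<beta> = rt p" "p \<in> Z" by blast
    then obtain x y where xy: "\<beta> = rt (x, y)" "(x, y) \<in> Z" by (cases p) simp
    then have "\<beta> a = 0" "\<beta> b = 0" using Z by (auto simp: rt_apply)
    moreover have "\<alpha> a \<noteq> 0" using ne by (simp add: \<alpha>_def rt_apply)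
    ultimately show ?thesis unfolding \<alpha>_def wform_rt[OF ab] by auto
  qed
  have Y: "\<beta> \<noteq> \<alpha> \<and> wform m n \<beta> \<alpha> \<noteq> 0" if "\<beta> \<in> Y" for \<beta>
  proof -
    have "rt (c, a) a + rt (c, a) b \<noteq> 0" if "c \<in> L" for c
      using LR[of c] that ne by (simp add: rt_apply)
    moreover have "rt (b, c) a + rt (b, c) b \<noteq> 0" if "c \<in> R" for c
      using LR[of c] that ne by (simp add: rt_apply)
    ultimately have "\<beta> a + \<beta> b \<noteq> 0" using that unfolding Y_def by auto
    moreover have "\<alpha> a + \<alpha> b = 0" using ne by (simp add: \<alpha>_def rt_apply)
    ultimately show ?thesis unfolding \<alpha>_def wform_rt[OF ab] by metis
  qed
  have S: "base_of (us @ a # b # ws) - {\<alpha>} = X \<union> Y"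
  proof -
    have "base_of (us @ a # b # ws) = insert \<alpha> (X \<union> Y)"
      unfolding base_of_def adj1 X_def Y_def \<alpha>_def by (simp add: image_Un image_image Un_assoc)
    then show ?thesis using X Y by blast
  qed
  have "odd_reflection m n \<alpha> (base_of (us @ a # b # ws)) = insert (- \<alpha>) (X \<union> (\<lambda>\<beta>. \<beta> + \<alpha>) ` Y)"
    unfolding odd_reflection_def S using X Y by blast
  also have "(\<lambda>\<beta>. \<beta> + \<alpha>) ` Y = (\<lambda>c. rt (c, b)) ` L \<union> (\<lambda>c. rt (a, c)) ` R"
    unfolding Y_def \<alpha>_def image_Un image_image rt_add
    by (simp add: add.commute[of "rt (b, _)"] rt_add)
  also have "insert (- \<alpha>) (X \<union> \<dots>) = base_of (us @ b # a # ws)"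
    unfolding base_of_def adj2 X_def \<alpha>_def rt_minus
    by (simp add: image_Un image_image Un_assoc)
  finally show ?thesis unfolding \<alpha>_def .
qed

section \<open>Inversions of shuffles and down-sets of odd roots\<close>

text \<open>Under \<open>rt\<close> and for a shuffle, these are the right odd roots that are
  negative for \<open>base_of xs\<close>, each indexed with its \<open>\<epsilon>\<close> letter
  first.\<close>

definition cross_inversions :: "nat \<Rightarrow> nat list \<Rightarrow> (nat \<times> nat) set" where
  "cross_inversions m xs = {(a, b). a \<le> m \<and> m < b \<and> (b, a) \<in> before xs}"

definition odd_index_le :: "nat \<times> nat \<Rightarrow> nat \<times> nat \<Rightarrow> bool" where
  "odd_index_le p q \<longleftrightarrow> fst q \<le> fst p \<and> snd p \<le> snd q"

definition odd_downset :: "nat \<Rightarrow> nat \<Rightarrow> (nat \<times> nat) set \<Rightarrow> bool" where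
  "odd_downset m n D \<longleftrightarrow> D \<subseteq> {1..m} \<times> {m+1..m+n} \<and>
     (\<forall>q\<in>D. \<forall>p\<in>{1..m} \<times> {m+1..m+n}. odd_index_le p q \<longrightarrow> p \<in> D)"

text \<open>If \<open>b\<close> precedes \<open>a\<close>, then a large letter
  \<open>d \<le> b\<close> stands at or before \<open>b\<close> and a small letter
  \<open>c \<ge> a\<close> at or after \<open>a\<close>, so \<open>d\<close> precedes
  \<open>c\<close>.\<close>

lemma cross_inversions_downset:
  assumes xs: "shuffle_list m n xs"
  shows "odd_downset m n (cross_inversions m xs)"
proof -
  note sD = shuffle_listD[OF xs]
  have "(d, c) \<in> before xs"
    if "(b, a) \<in> before xs" "a \<le> m" "m < b" "c \<in> {1..m}" "d \<in> {m+1..m+n}" "a \<le> c" "d \<le> b"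
    for a b c d
  proof -
    have ab: "a \<in> {1..m+n}" "b \<in> {1..m+n}" using before_in_set[OF that(1)] sD(2) by auto
    have "d = b \<or> (d, b) \<in> before xs"
      using shuffle_list_less_before[OF xs, of d b] that ab by (cases "d = b") auto
    moreover have "a = c \<or> (a, c) \<in> before xs"
      using shuffle_list_less_before[OF xs, of a c] that ab by (cases "a = c") auto
    ultimately show ?thesis using before_trans[OF sD(1)] that(1) by metis
  qed
  note closed = this
  have sub: "cross_inversions m xs \<subseteq> {1..m} \<times> {m+1..m+n}"
    using before_in_set[of _ _ xs] unfolding cross_inversions_def sD(2) by fastforce
  moreover have "p \<in> cross_inversions m xs"
    if "q \<in> cross_inversions m xs" "p \<in> {1..m} \<times> {m+1..m+n}" "odd_index_le p q" for p q
  proof -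
    obtain a b c d where pq: "q = (a, b)" "p = (c, d)" by fastforce
    have "(d, c) \<in> before xs"
      using that unfolding pq cross_inversions_def odd_index_le_def
      by (intro closed[of b a c d]) simp_all
    then show ?thesis using that(2) unfolding pq cross_inversions_def by simp
  qed
  ultimately show ?thesis unfolding odd_downset_def by blast
qed

text \<open>The order of two letters of the same kind is forced, so only the mixed pairs carry
  information. By symmetry one inclusion of the orders suffices.\<close>

lemma cross_inversions_inject:
  assumes xs: "shuffle_list m n xs" and ys: "shuffle_list m n ys"
    and eq: "cross_inversions m xs = cross_inversions m ys"
  shows "xs = ys"
proof -
  have *: "before xs \<subseteq> before ys"
    if "shuffle_list m n xs" "shuffle_list m n ys" "cross_inversions m xs = cross_inversions m ys"
    for xs ys
  proof (rule subrelI)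
    fix a b assume ab: "(a, b) \<in> before xs"
    then have abI: "a \<in> {1..m+n}" "b \<in> {1..m+n}" "a \<noteq> b"
      using before_in_set[OF ab] shuffle_listD(2)[OF that(1)]
        before_irrefl[OF shuffle_listD(1)[OF that(1)], of a] ab by auto
    consider "a \<le> m \<longleftrightarrow> b \<le> m" | "a \<le> m" "m < b" | "m < a" "b \<le> m" by linarith
    then show "(a, b) \<in> before ys"
    proof cases
      case 1
      then show ?thesis
        using shuffle_listD(3)[OF that(1) ab] shuffle_list_less_before[OF that(2)] abI by blast
    next
      case 2
      then have "(a, b) \<notin> cross_inversions m xs"
        using before_asym[OF shuffle_listD(1)[OF that(1)] ab] unfolding cross_inversions_def by blast
      then have "(b, a) \<notin> before ys" using 2 that(3) unfolding cross_inversions_def by blast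
      then show ?thesis using before_total[of a ys b] abI shuffle_listD(2)[OF that(2)] by auto
    next
      case 3
      then show ?thesis using ab that(3) unfolding cross_inversions_def by blast
    qed
  qed
  show ?thesis
    using before_inject[of xs ys] shuffle_listD[OF xs] shuffle_listD[OF ys]
      *[OF xs ys eq] *[OF ys xs eq[symmetric]] by auto
qed

text \<open>\<open>fold\<close> applies the entries from left to right, and \<open>as ! t\<close>
  counts from 0: it must be simple after the first \<open>t\<close> reflections.\<close>

definition reflection_path :: "nat \<Rightarrow> nat \<Rightarrow> weight list \<Rightarrow> weight set \<Rightarrow> bool" where
  "reflection_path m n as S \<longleftrightarrow>
     (\<forall>t<length as. as ! t \<in> fold (odd_reflection m n) (take t as) (dist_base m n)) \<and>
     fold (odd_reflection m n) as (dist_base m n) = S"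

lemma reflection_path_snoc:
  assumes "reflection_path m n as S" "\<alpha> \<in> S"
  shows "reflection_path m n (as @ [\<alpha>]) (odd_reflection m n \<alpha> S)"
  using assms unfolding reflection_path_def by (auto simp: nth_append less_Suc_eq)

text \<open>Removing a maximal element from a down-set leaves a shuffle in which the two corresponding
  letters are adjacent, since any letter between them would yield a larger element.\<close>

lemma downset_path:
  assumes "odd_downset m n D"
  shows "\<exists>xs ps. shuffle_list m n xs \<and> cross_inversions m xs = D \<and> distinct ps \<and> set ps = D \<and>
     reflection_path m n (map rt ps) (base_of xs)"
  using assms
proof (induction "card D" arbitrary: D)
  case 0
  have "finite D" using 0(2) finite_subset unfolding odd_downset_def by blast
  then have "D = {}" using 0 by auto
  moreover have "cross_inversions m [1..<Suc (m + n)] = {}"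
    unfolding cross_inversions_def in_before_upt by auto
  moreover have "reflection_path m n [] (base_of [1..<Suc (m + n)])"
    unfolding reflection_path_def dist_base_base_of by simp
  ultimately show ?case using shuffle_list_upt[of m n]
    by (intro exI[of _ "[1..<Suc (m + n)]"] exI[of _ "[]"]) (simp del: upt_Suc)
next
  case (Suc k)
  have sub: "D \<subseteq> {1..m} \<times> {m+1..m+n}" using Suc.prems unfolding odd_downset_def by blast
  then have fin: "finite D" using finite_subset by blast
  have "D \<noteq> {}" using Suc.hyps(2) by auto
  \<comment> \<open>\<open>f\<close> increases strictly along \<open>odd_index_le\<close>, so an
    element where it is largest is maximal in \<open>D\<close>. The truncated \<open>m - a\<close>
    is exact because \<open>a \<le> m\<close> on \<open>D\<close>.\<close>
  define f :: "nat \<times> nat \<Rightarrow> nat" where "f = (\<lambda>(a, b). b + (m - a))"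
  have "Max (f ` D) \<in> f ` D" using fin \<open>D \<noteq> {}\<close> by (intro Max_in) auto
  then obtain q where "q \<in> D" "f q = Max (f ` D)" by (metis imageE)
  then have q: "q \<in> D" "\<And>p. p \<in> D \<Longrightarrow> f p \<le> f q" using fin by auto
  obtain a b where ab: "q = (a, b)" by fastforce
  have abI: "a \<in> {1..m}" "b \<in> {m+1..m+n}" using q(1) sub ab by auto
  have qmax: "p = q" if "p \<in> D" "odd_index_le q p" for p
    using q(2)[OF that(1)] that sub abI ab unfolding f_def odd_index_le_def by auto
  have down: "odd_downset m n (D - {q})"
    using Suc.prems qmax unfolding odd_downset_def by blast
  have card: "k = card (D - {q})" using Suc.hyps(2) q(1) fin by simp
  obtain xs ps where xs: "shuffle_list m n xs" "cross_inversions m xs = D - {q}"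
    and ps: "distinct ps" "set ps = D - {q}" "reflection_path m n (map rt ps) (base_of xs)"
    using Suc.hyps(1)[OF card down] by blast
  note sD = shuffle_listD[OF xs(1)]
  have inv_iff: "(c, d) \<in> D - {q} \<longleftrightarrow> c \<le> m \<and> m < d \<and> (d, c) \<in> before xs" for c d
    unfolding xs(2)[symmetric] cross_inversions_def by simp
  have "(b, a) \<notin> before xs" using inv_iff[of a b] abI unfolding ab by simp
  then have "(a, b) \<in> before xs" using before_total[of a xs b] sD(2) abI by auto
  then obtain us vs ws where dec: "xs = us @ a # vs @ b # ws" using before_decomp by metis
  have "vs = []"
  proof (rule ccontr)
    assume "vs \<noteq> []"
    then obtain c where c: "c \<in> set vs" by (meson last_in_set)
    have ac: "(a, c) \<in> before xs" and cb: "(c, b) \<in> before xs"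
      using c by (auto simp: dec before_append)
    have cI: "c \<in> {1..m+n}" using c sD(2) dec by auto
    show False
    \<comment> \<open>A small \<open>c\<close> gives \<open>(c, b)\<close>, a large one
      \<open>(a, c)\<close>, strictly below \<open>q\<close>. Down-closure makes that pair an
      inversion of \<open>xs\<close>, contradicting the position of \<open>c\<close> between
      \<open>a\<close> and \<open>b\<close>.\<close>
    proof (cases "c \<le> m")
      case True
      then have "a < c" using sD(3)[OF ac] abI by auto
      then have "odd_index_le (c, b) q" "(c, b) \<in> {1..m} \<times> {m+1..m+n}"
        using True cI abI unfolding odd_index_le_def ab by auto
      then have "(c, b) \<in> D - {q}"
        using Suc.prems q(1) \<open>a < c\<close> unfolding odd_downset_def ab by blast
      then show False using inv_iff before_asym[OF sD(1) cb] by simp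
    next
      case False
      then have "c < b" using sD(3)[OF cb] abI by auto
      then have "odd_index_le (a, c) q" "(a, c) \<in> {1..m} \<times> {m+1..m+n}"
        using False cI abI unfolding odd_index_le_def ab by auto
      then have "(a, c) \<in> D - {q}"
        using Suc.prems q(1) \<open>c < b\<close> unfolding odd_downset_def ab by blast
      then show False using inv_iff before_asym[OF sD(1) ac] by simp
    qed
  qed
  then have dec: "xs = us @ a # b # ws" using dec by simp
  let ?ys = "us @ b # a # ws"
  have before_ys: "before ?ys = insert (b, a) (before xs - {(a, b)})"
    unfolding dec by (rule before_swap[OF sD(1)[unfolded dec]])
  have ys: "shuffle_list m n ?ys"
  proof -
    have "distinct ?ys" using sD(1) unfolding dec by auto
    moreover have "set ?ys = {1..m+n}" unfolding sD(2)[symmetric] dec by auto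
    moreover have "c < d" if "(c, d) \<in> before ?ys" "c \<le> m \<longleftrightarrow> d \<le> m" for c d
    proof -
      have "(c, d) \<noteq> (b, a)" using that(2) abI by auto
      then have "(c, d) \<in> before xs" using that(1) unfolding before_ys by blast
      then show ?thesis using that(2) by (rule sD(3))
    qed
    ultimately show ?thesis unfolding shuffle_list_def by simp
  qed
  have inv: "cross_inversions m ?ys = D"
  proof -
    have "(c, d) \<in> cross_inversions m ?ys \<longleftrightarrow> (c, d) \<in> D" for c d
    proof (cases "(c, d) = q")
      case True
      then show ?thesis using q(1) abI unfolding cross_inversions_def before_ys ab by simp
    next
      case False
      moreover have "(d, c) \<noteq> (a, b)" if "c \<le> m" using that abI by auto
      ultimately show ?thesis
        using inv_iff[of c d] unfolding cross_inversions_def before_ys ab by auto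
    qed
    then show ?thesis by (intro set_eqI) (simp only: split_paired_all)
  qed
  have "(a, b) \<in> adj xs" by (simp add: dec adj_append)
  then have qin: "rt q \<in> base_of xs" unfolding base_of_def ab by (rule imageI)
  have refl: "odd_reflection m n (rt q) (base_of xs) = base_of ?ys"
    unfolding ab dec using odd_reflection_base_of[OF sD(1)[unfolded dec] abI] .
  have "reflection_path m n (map rt (ps @ [q])) (base_of ?ys)"
    using reflection_path_snoc[OF ps(3) qin] unfolding refl by simp
  then have "shuffle_list m n ?ys \<and> cross_inversions m ?ys = D \<and> distinct (ps @ [q]) \<and>
      set (ps @ [q]) = D \<and> reflection_path m n (map rt (ps @ [q])) (base_of ?ys)"
    using ys inv ps(1,2) q(1) by (simp add: insert_absorb)
  then show ?case by (rule_tac exI, rule_tac exI)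
qed

section \<open>Simple right odd roots as antichains of index pairs\<close>

definition odd_pairs :: "nat \<Rightarrow> nat \<Rightarrow> (nat \<times> nat) set" where
  "odd_pairs m n = {1..m} \<times> {m+1..m+n}"

definition simple_odd :: "nat \<Rightarrow> nat list \<Rightarrow> (nat \<times> nat) set" where
  "simple_odd m xs = {(a, b) \<in> adj xs. a \<le> m \<and> m < b}"

lemma rt_inj_odd: "inj_on rt (odd_pairs m n)"
  by (auto simp: inj_on_def rt_eq_iff odd_pairs_def)

lemma simple_odd_subset: "shuffle_list m n xs \<Longrightarrow> simple_odd m xs \<subseteq> odd_pairs m n"
  using adj_in_set[of _ _ xs] shuffle_listD(2)[of m n xs]
  unfolding simple_odd_def odd_pairs_def by fastforce

lemma base_of_Int_right_odd:
  assumes xs: "shuffle_list m n xs"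
  shows "base_of xs \<inter> right_odd_roots m n = rt ` simple_odd m xs"
proof (intro equalityI subsetI)
  fix x assume "x \<in> base_of xs \<inter> right_odd_roots m n"
  then have "x \<in> rt ` adj xs" "x \<in> rt ` odd_pairs m n"
    unfolding base_of_def right_odd_roots_rt odd_pairs_def by simp_all
  then obtain p q where pq: "x = rt p" "p \<in> adj xs" "x = rt q" "q \<in> odd_pairs m n" by blast
  obtain a b c d where p: "p = (a, b)" and q: "q = (c, d)" by fastforce
  have cd: "c \<le> m" "m < d" using pq(4) unfolding q odd_pairs_def by auto
  have "a \<noteq> b" using pq(2) adj_neq[OF shuffle_listD(1)[OF xs], of a b] unfolding p by simp
  then have "a = c" "b = d" using rt_eq_iff[of a b c d] pq(1,3) cd unfolding p q by simp_all
  then have "p \<in> simple_odd m xs" using pq(2) cd unfolding simple_odd_def p by simp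
  then show "x \<in> rt ` simple_odd m xs" using pq(1) by blast
next
  fix x assume "x \<in> rt ` simple_odd m xs"
  then show "x \<in> base_of xs \<inter> right_odd_roots m n"
    using simple_odd_subset[OF xs]
    unfolding base_of_def right_odd_roots_rt odd_pairs_def simple_odd_def by auto
qed

text \<open>An inversion above a simple pair would make that pair an inversion too, by down-closure.
  Conversely, if \<open>a\<close> precedes \<open>b\<close>, then \<open>before_switch\<close> finds
  a simple pair between them, and the shuffle condition puts it below \<open>(a, b)\<close>.\<close>

lemma simple_odd_upset:
  assumes xs: "shuffle_list m n xs" and p: "p \<in> odd_pairs m n"
  shows "(\<exists>q\<in>simple_odd m xs. odd_index_le q p) \<longleftrightarrow> p \<notin> cross_inversions m xs"
proof -
  obtain a b where ab: "p = (a, b)" by fastforce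
  note sD = shuffle_listD[OF xs]
  have abI: "a \<in> {1..m}" "b \<in> {m+1..m+n}" using p ab unfolding odd_pairs_def by auto
  show ?thesis
  proof
    assume "\<exists>q\<in>simple_odd m xs. odd_index_le q p"
    then obtain c d where cd: "(c, d) \<in> simple_odd m xs" "a \<le> c" "d \<le> b"
      using ab unfolding odd_index_le_def by fastforce
    show "p \<notin> cross_inversions m xs"
    proof
      assume "p \<in> cross_inversions m xs"
      then have "(c, d) \<in> cross_inversions m xs"
        using cross_inversions_downset[OF xs] simple_odd_subset[OF xs] cd ab
        unfolding odd_downset_def odd_pairs_def odd_index_le_def by force
      then have "(d, c) \<in> before xs" unfolding cross_inversions_def by blast
      moreover have "(c, d) \<in> before xs" using cd(1) adj_before unfolding simple_odd_def by blast
      ultimately show False using before_asym[OF sD(1)] by blast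
    qed
  next
    assume "p \<notin> cross_inversions m xs"
    then have "(b, a) \<notin> before xs" using ab abI unfolding cross_inversions_def by auto
    then have "(a, b) \<in> before xs" using before_total[of a xs b] sD(2) abI by auto
    then obtain c d where cd: "(c, d) \<in> adj xs" "c \<le> m" "m < d"
        "a = c \<or> (a, c) \<in> before xs" "d = b \<or> (d, b) \<in> before xs"
      using before_switch[of a b xs m] abI by auto
    then have "a \<le> c" "d \<le> b" using sD(3)[of a c] sD(3)[of d b] abI by auto
    then show "\<exists>q\<in>simple_odd m xs. odd_index_le q p"
      using cd ab unfolding simple_odd_def odd_index_le_def by (intro bexI[of _ "(c, d)"]) auto
  qed
qed

definition odd_antichain :: "(nat \<times> nat) set \<Rightarrow> bool" where
  "odd_antichain A \<longleftrightarrow> (\<forall>p\<in>A. \<forall>q\<in>A. odd_index_le p q \<longrightarrow> p = q)"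

text \<open>If \<open>c < a\<close>, then \<open>c\<close> precedes \<open>a\<close>, and so does
  its successor \<open>d\<close>; hence \<open>d\<close> precedes \<open>b\<close> and
  \<open>d < b\<close>, against \<open>b \<le> d\<close>. If \<open>a = c\<close>, the successors
  agree.\<close>

lemma simple_odd_antichain:
  assumes xs: "shuffle_list m n xs"
  shows "odd_antichain (simple_odd m xs)"
proof -
  note sD = shuffle_listD[OF xs]
  have "a = c \<and> b = d" if ab: "(a, b) \<in> simple_odd m xs" and cd: "(c, d) \<in> simple_odd m xs"
    and le: "c \<le> a" "b \<le> d" for a b c d
  proof -
    have A: "(a, b) \<in> adj xs" "(c, d) \<in> adj xs" "a \<le> m" "m < b" "c \<le> m" "m < d"
      using ab cd unfolding simple_odd_def by auto
    then have B: "(a, b) \<in> before xs" "(c, d) \<in> before xs" using adj_before by auto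
    then have I: "a \<in> {1..m+n}" "c \<in> {1..m+n}"
      using before_in_set[of a b xs] before_in_set[of c d xs] unfolding sD(2) by simp_all
    have ac: "a = c"
    proof (rule ccontr)
      assume "a \<noteq> c"
      then have "(c, a) \<in> before xs"
        using le(1) A(3,5) by (intro shuffle_list_less_before[OF xs I(2,1)]) auto
      then have "a = d \<or> (d, a) \<in> before xs" by (rule adj_before_cases[OF sD(1) A(2)])
      then have "(d, a) \<in> before xs" using A(3,6) by auto
      then have "(d, b) \<in> before xs" using B(1) by (rule before_trans[OF sD(1)])
      then have "d < b" using A(4,6) by (intro sD(3)) auto
      then show False using le(2) by simp
    qed
    have "d = b \<or> (b, d) \<in> before xs"
      using adj_before_cases[OF sD(1) A(1), of d] B(2) unfolding ac by simp
    moreover have "b = d \<or> (d, b) \<in> before xs"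
      using adj_before_cases[OF sD(1) A(2), of b] B(1) unfolding ac by simp
    ultimately show ?thesis using ac before_asym[OF sD(1), of b d] by auto
  qed
  then show ?thesis unfolding odd_antichain_def odd_index_le_def by (auto simp: prod_eq_iff)
qed

text \<open>An antichain is the set of minimal elements of the up-set it generates.\<close>

lemma odd_antichain_eq:
  assumes "odd_antichain A" "odd_antichain B"
    and "\<And>p. p \<in> A \<union> B \<Longrightarrow> (\<exists>q\<in>A. odd_index_le q p) \<longleftrightarrow> (\<exists>q\<in>B. odd_index_le q p)"
  shows "A = B"
proof -
  have refl: "odd_index_le p p" for p by (simp add: odd_index_le_def)
  have trans: "odd_index_le p r" if "odd_index_le p q" "odd_index_le q r" for p q r
    using that by (auto simp: odd_index_le_def)
  have antisym: "p = q" if "odd_index_le p q" "odd_index_le q p" for p q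
    using that by (auto simp: odd_index_le_def prod_eq_iff)
  have "A \<subseteq> B" if H: "odd_antichain A" "odd_antichain B"
    "\<And>p. p \<in> A \<union> B \<Longrightarrow> (\<exists>q\<in>A. odd_index_le q p) \<longleftrightarrow> (\<exists>q\<in>B. odd_index_le q p)" for A B
  proof
    fix p assume p: "p \<in> A"
    then obtain q where q: "q \<in> B" "odd_index_le q p" using H(3) refl by blast
    then obtain r where r: "r \<in> A" "odd_index_le r q" using H(3) refl by blast
    then have "r = p" using H(1) p trans q unfolding odd_antichain_def by blast
    then show "p \<in> B" using antisym q r by blast
  qed
  from this[of A B] this[of B A] show ?thesis using assms by blast
qed

section \<open>From index pairs back to weights\<close>

lemma odd_le_rt:
  assumes "p \<in> odd_pairs m n" "q \<in> odd_pairs m n"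
  shows "odd_le m n (rt p) (rt q) \<longleftrightarrow> odd_index_le p q"
proof -
  obtain a b c d where p: "p = (a, b)" "q = (c, d)" by fastforce
  have I: "a \<in> {1..m}" "c \<in> {1..m}" "b \<in> {m+1..m+n}" "d \<in> {m+1..m+n}"
    using assms p unfolding odd_pairs_def by auto
  show ?thesis
  proof
    assume "odd_le m n (rt p) (rt q)"
    then obtain i j k l where ijkl: "i \<in> {1..m}" "k \<in> {1..m}" "j \<in> {1..n}" "l \<in> {1..n}"
        "rt (a, b) = rt (i, m + j)" "rt (c, d) = rt (k, m + l)" and le: "k \<le> i" "j \<le> l"
      unfolding odd_le_def p del_eps by (auto simp: rt_def)
    have "a = i \<and> b = m + j" "c = k \<and> d = m + l"
      using I ijkl rt_eq_iff[of a b i "m + j"] rt_eq_iff[of c d k "m + l"] by auto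
    then show "odd_index_le p q" unfolding p odd_index_le_def using le by simp
  next
    assume "odd_index_le p q"
    then have le: "c \<le> a" "b - m \<le> d - m" unfolding p odd_index_le_def by (simp_all add: diff_le_mono)
    have J: "b - m \<in> {1..n}" "d - m \<in> {1..n}" using I(3,4) by auto
    have "rt p = eps a - del m (b - m)" "rt q = eps c - del m (d - m)"
      using I(3,4) unfolding p rt_def del_eps by simp_all
    then show "odd_le m n (rt p) (rt q)"
      unfolding odd_le_def using I(1,2) J le by blast
  qed
qed

lemma incomparable_rt:
  "incomparable m n A \<longleftrightarrow> (\<exists>P \<subseteq> odd_pairs m n. odd_antichain P \<and> A = rt ` P)"
proof
  assume A: "incomparable m n A"
  then have "A \<subseteq> rt ` odd_pairs m n"
    unfolding incomparable_def right_odd_roots_rt odd_pairs_def by blast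
  then obtain P where P: "P \<subseteq> odd_pairs m n" "A = rt ` P" by (auto simp: subset_image_iff)
  have "odd_antichain P" unfolding odd_antichain_def
  proof (intro ballI impI)
    fix p q assume pq: "p \<in> P" "q \<in> P" "odd_index_le p q"
    then have "odd_le m n (rt p) (rt q)" using odd_le_rt P by blast
    then have "rt p = rt q" using A pq unfolding incomparable_def P(2) by blast
    then show "p = q" using rt_inj_odd[of m n] P pq unfolding inj_on_def by blast
  qed
  then show "\<exists>P \<subseteq> odd_pairs m n. odd_antichain P \<and> A = rt ` P" using P by blast
next
  assume "\<exists>P \<subseteq> odd_pairs m n. odd_antichain P \<and> A = rt ` P"
  then obtain P where P: "P \<subseteq> odd_pairs m n" "odd_antichain P" "A = rt ` P" by blast
  have "p = q" if "p \<in> P" "q \<in> P" "odd_le m n (rt p) (rt q)" for p q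
  proof -
    have "p \<in> odd_pairs m n" "q \<in> odd_pairs m n" using P(1) that(1,2) by auto
    then have "odd_index_le p q" using odd_le_rt that(3) by simp
    then show ?thesis using P(2) that(1,2) unfolding odd_antichain_def by simp
  qed
  moreover have "A \<subseteq> right_odd_roots m n"
    unfolding right_odd_roots_rt odd_pairs_def[symmetric] P(3) using P(1) by (rule image_mono)
  ultimately show "incomparable m n A" unfolding incomparable_def P(3) by fast
qed

lemma B_set_base_of:
  assumes xs: "shuffle_list m n xs"
  shows "B_set m n (base_of xs) = rt ` cross_inversions m xs"
proof -
  have sub: "cross_inversions m xs \<subseteq> odd_pairs m n"
    using cross_inversions_downset[OF xs] unfolding odd_downset_def odd_pairs_def by blast
  have "rt p \<in> B_set m n (base_of xs) \<longleftrightarrow> p \<in> cross_inversions m xs"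
    if p: "p \<in> odd_pairs m n" for p
  proof -
    have "rt p \<in> right_odd_roots m n" using p unfolding right_odd_roots_rt odd_pairs_def by blast
    then have "rt p \<in> B_set m n (base_of xs) \<longleftrightarrow>
        \<not> (\<exists>q\<in>simple_odd m xs. odd_le m n (rt q) (rt p))"
      unfolding B_set_def base_of_Int_right_odd[OF xs] by blast
    also have "\<dots> \<longleftrightarrow> \<not> (\<exists>q\<in>simple_odd m xs. odd_index_le q p)"
      using odd_le_rt[OF _ p] simple_odd_subset[OF xs] by blast
    finally show ?thesis using simple_odd_upset[OF xs p] by blast
  qed
  moreover have "B_set m n (base_of xs) \<subseteq> rt ` odd_pairs m n"
    unfolding B_set_def right_odd_roots_rt odd_pairs_def by blast
  ultimately show ?thesis using sub by blast
qed

text \<open>The simple pairs determine the inversion set by \<open>simple_odd_upset\<close>, and the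
  inversions determine the list. Conversely, every antichain arises from the complement of its
  up-set.\<close>

lemma simple_odd_bij:
  "bij_betw (simple_odd m) {xs. shuffle_list m n xs} {P. P \<subseteq> odd_pairs m n \<and> odd_antichain P}"
proof (rule bij_betw_imageI)
  show "inj_on (simple_odd m) {xs. shuffle_list m n xs}"
  proof (rule inj_onI)
    fix xs ys assume "xs \<in> {xs. shuffle_list m n xs}" "ys \<in> {xs. shuffle_list m n xs}"
      and eq: "simple_odd m xs = simple_odd m ys"
    then have xy: "shuffle_list m n xs" "shuffle_list m n ys" by auto
    have "p \<in> cross_inversions m xs \<longleftrightarrow> p \<in> cross_inversions m ys" if "p \<in> odd_pairs m n" for p
      using simple_odd_upset[OF xy(1) that] simple_odd_upset[OF xy(2) that] eq by simp
    moreover have "cross_inversions m xs \<subseteq> odd_pairs m n" "cross_inversions m ys \<subseteq> odd_pairs m n"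
      using cross_inversions_downset[OF xy(1)] cross_inversions_downset[OF xy(2)]
      unfolding odd_downset_def odd_pairs_def by simp_all
    ultimately have "cross_inversions m xs = cross_inversions m ys" by blast
    then show "xs = ys" by (rule cross_inversions_inject[OF xy])
  qed
  show "simple_odd m ` {xs. shuffle_list m n xs} = {P. P \<subseteq> odd_pairs m n \<and> odd_antichain P}"
  proof (intro equalityI subsetI)
    fix P assume "P \<in> {P. P \<subseteq> odd_pairs m n \<and> odd_antichain P}"
    then have P: "P \<subseteq> odd_pairs m n" "odd_antichain P" by auto
    \<comment> \<open>\<open>D\<close> has to be the inversion set of the list sought;
      \<open>downset_path\<close> realizes it, and both antichains then generate the same
      up-set.\<close>
    define D where "D = {p \<in> odd_pairs m n. \<not> (\<exists>q\<in>P. odd_index_le q p)}"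
    have "p \<in> D" if "q \<in> D" "p \<in> odd_pairs m n" "odd_index_le p q" for p q
    proof -
      have "odd_index_le r q" if "odd_index_le r p" for r
        using that \<open>odd_index_le p q\<close> unfolding odd_index_le_def by simp
      then show ?thesis using that(1,2) unfolding D_def by blast
    qed
    moreover have "D \<subseteq> odd_pairs m n" unfolding D_def by blast
    ultimately have "odd_downset m n D" unfolding odd_downset_def odd_pairs_def by blast
    then obtain xs where xs: "shuffle_list m n xs" "cross_inversions m xs = D"
      using downset_path by blast
    have "simple_odd m xs = P"
    proof (rule odd_antichain_eq[OF simple_odd_antichain[OF xs(1)] P(2)])
      fix p assume "p \<in> simple_odd m xs \<union> P"
      then have "p \<in> odd_pairs m n" using P(1) simple_odd_subset[OF xs(1)] by blast
      then show "(\<exists>q\<in>simple_odd m xs. odd_index_le q p) \<longleftrightarrow> (\<exists>q\<in>P. odd_index_le q p)"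
        using simple_odd_upset[OF xs(1), of p] unfolding xs(2) D_def by simp
    qed
    then show "P \<in> simple_odd m ` {xs. shuffle_list m n xs}" using xs(1) by blast
  qed (use simple_odd_subset simple_odd_antichain in blast)
qed

theorem theorem1:
  fixes m n :: nat
  shows "bij_betw (\<lambda>S. S \<inter> right_odd_roots m n) (bases_SS m n) {A. incomparable m n A} \<and>
    (\<forall>S\<in>bases_SS m n. \<exists>as :: weight list.
       distinct as \<and> set as = B_set m n S \<and>
       (\<forall>t<length as. as ! t \<in> fold (odd_reflection m n) (take t as) (dist_base m n)) \<and>
       fold (odd_reflection m n) as (dist_base m n) = S)"
proof
  let ?X = "{xs. shuffle_list m n xs}" and ?P = "{P. P \<subseteq> odd_pairs m n \<and> odd_antichain P}"
  have "inj_on ((`) rt) ?P"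
    using rt_inj_odd[of m n] by (auto simp: inj_on_def inj_on_image_eq_iff)
  moreover have "(`) rt ` ?P = {A. incomparable m n A}"
    unfolding incomparable_rt by blast
  ultimately have "bij_betw ((`) rt) ?P {A. incomparable m n A}" by (rule bij_betw_imageI)
  then have bij: "bij_betw ((`) rt \<circ> simple_odd m) ?X {A. incomparable m n A}"
    by (rule bij_betw_trans[OF simple_odd_bij])
  have eq: "(\<lambda>S. S \<inter> right_odd_roots m n) (base_of xs) = ((`) rt \<circ> simple_odd m) xs"
    if "xs \<in> ?X" for xs
    using base_of_Int_right_odd that by simp
  \<comment> \<open>Injectivity of \<open>base_of\<close> is inherited from the composite with
    intersection by the right odd roots, which is already known to be bijective.\<close>
  have "inj_on base_of ?X"
    using bij_betw_imp_inj_on[OF bij] eq unfolding inj_on_def by metis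
  then have b: "bij_betw base_of ?X (bases_SS m n)"
    by (simp add: bij_betw_def bases_SS_eq)
  have "bij_betw ((\<lambda>S. S \<inter> right_odd_roots m n) \<circ> base_of) ?X {A. incomparable m n A}"
    using bij bij_betw_cong[of ?X "(`) rt \<circ> simple_odd m" "(\<lambda>S. S \<inter> right_odd_roots m n) \<circ> base_of"] eq
    by simp
  then show "bij_betw (\<lambda>S. S \<inter> right_odd_roots m n) (bases_SS m n) {A. incomparable m n A}"
    using bij_betw_comp_iff[OF b] by blast
  show "\<forall>S\<in>bases_SS m n. \<exists>as :: weight list.
       distinct as \<and> set as = B_set m n S \<and>
       (\<forall>t<length as. as ! t \<in> fold (odd_reflection m n) (take t as) (dist_base m n)) \<and>
       fold (odd_reflection m n) as (dist_base m n) = S"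
  proof
    fix S assume "S \<in> bases_SS m n"
    then obtain xs where xs: "shuffle_list m n xs" "S = base_of xs" unfolding bases_SS_eq by blast
    note down = cross_inversions_downset[OF xs(1)]
    \<comment> \<open>The path ends at some list \<open>ys\<close> with the inversions of
      \<open>xs\<close>; injectivity of inversion sets then identifies the two lists.\<close>
    obtain ys ps where ys: "shuffle_list m n ys" "cross_inversions m ys = cross_inversions m xs"
      and ps: "distinct ps" "set ps = cross_inversions m xs"
        "reflection_path m n (map rt ps) (base_of ys)"
      using downset_path[OF down] by blast
    have "ys = xs" using cross_inversions_inject[OF ys(1) xs(1) ys(2)] .
    then have "reflection_path m n (map rt ps) S" using ps(3) xs(2) by simp
    moreover have "set ps \<subseteq> odd_pairs m n"
      using down unfolding ps(2) odd_downset_def odd_pairs_def by blast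
    then have "distinct (map rt ps)"
      using inj_on_subset[OF rt_inj_odd] ps(1) unfolding distinct_map by blast
    moreover have "set (map rt ps) = B_set m n S"
      using B_set_base_of[OF xs(1)] unfolding xs(2) set_map ps(2) by (rule sym)
    ultimately show "\<exists>as. distinct as \<and> set as = B_set m n S \<and>
       (\<forall>t<length as. as ! t \<in> fold (odd_reflection m n) (take t as) (dist_base m n)) \<and>
       fold (odd_reflection m n) as (dist_base m n) = S"
      unfolding reflection_path_def by blast
  qed
qed

end
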